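(* Let $d\ge1$ and let $(G,X)$ be a minimal topological dynamical system. Then the quotient map $\pi_d:(G,X)\to(G,X/\mathbf{NRP}^{[d]}(X))$ is the maximal factor of $(G,X)$ which is an ergodic nilspace of order at most $d$. That is, the dynamical cubespace induced by $(G,X/\mathbf{NRP}^{[d]}(X))$ is an ergodic nilspace of order at most $d$, and if $\phi:(G,X)\to(G,Y)$ is a factor map such that the dynamical cubespace $(Y,C_G^\bullet(Y))$ is an ergodic nilspace of order at most $d$, then there is a factor map $\psi:(G,X/\mathbf{NRP}^{[d]}(X))\to(G,Y)$ with $\phi=\psi\circ\pi_d$.
   Context: A topological dynamical system (t.d.s.) $(G,X)$ is a Hausdorff topological group $G$ acting continuously on a compact Hausdorff space $X$; it is minimal if every orbit $Gx$ is dense in $X$. A factor map is a surjective continuous $G$-equivariant map. For $d\ge 0$, $X^{[d]}$ is the set of maps $\{0,1\}^d\to X$ with the product topology, and for $x\in X$, $x^{[d]}\in X^{[d]}$ is the constant map with value $x$. For $h\in G$ and $F\subset\{0,1\}^d$, $[h]_F\in G^{[d]}=G^{\{0,1\}^d}$ is given by $[h]_F(\omega)=h$ if $\omega\in F$ and $[h]_F(\omega)=\mathrm{Id}$ otherwise. A hyperface of $\{0,1\}^d$ is a set $\{\omega:\omega_i=a\}$ with $1\le i\le d$, $a\in\{0,1\}$. The Host-Kra cube group $\mathcal{HK}^{[d]}$ is the subgroup of $G^{[d]}$ generated by all $[h]_F$ with $h\in G$ and $F$ a hyperface. It acts coordinatewise on $X^{[d]}$. The set of dynamical cubes is $C_G^{[d]}(X)=\overline{\{g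 x^{[d]}: g\in\mathcal{HK}^{[d]},\ x\in X\}}\subset X^{[d]}$. For $x,y\in X$, $\llcorner^{[d]}(x,y)\in X^{[d]}$ is the configuration with value $y$ at $\vec 1=(1,\dots,1)$ and value $x$ at all other $\omega\in\{0,1\}^d$. For $d\ge1$, the nilpotent regionally proximal relation of order $d$ is $\mathbf{NRP}^{[d]}(X)=\{(x,y)\in X\times X:\ \llcorner^{[d+1]}(x,y)\in C_G^{[d+1]}(X)\}$. For minimal $(G,X)$ it is a closed $G$-invariant equivalence relation, so $(G,X/\mathbf{NRP}^{[d]}(X))$ is a t.d.s. A morphism of discrete cubes $f=(f_1,\dots,f_k):\{0,1\}^d\to\{0,1\}^k$ is a map each of whose coordinates $f_j(\omega_1,\dots,\omega_d)$ is identically $0$, identically $1$, or equal to $\omega_i$ or $1-\omega_i$ for some $i=i(j)$. A cubespace $(X,C^\bullet)$ is a compact Hausdorff space $X$ with closed subsets $C^{[d]}(X)\subset X^{[d]}$ for each $d\ge0$ (whose elements are called $d$-cubes) such that $c\circ f\in C^{[d]}(X)$ for every morphism of discrete cubes $f:\{0,1\}^d\to\{0,1\}^k$ and every $c\in C^{[k]}(X)$. The dynamical cubespace induced by $(G,X)$ is $(X,C_G^\bullet)=(X,\{C_G^{[d]}(X)\}_{d\ge0})$; it is a cubespace. A cubespace is ergodic if $C^{[1]}(X)=X^{[1]}=X\times X$. A $d$-corner is a map $f:\{0,1\}^d\setminus\{\vec1\}\to X$ such that the restriction of $f$ to $\{\omega:\omega_i=0\}$ (identified with $\{0,1\}^{d-1}$)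 is a $(d-1)$-cube for all $1\le i\le d$. The cubespace has $d$-completion if every $d$-corner is the restriction of some $c\in C^{[d]}(X)$; it is fibrant if it has $d$-completion for all $d\ge1$. It has $d$-uniqueness if any $c,c'\in C^{[d]}(X)$ that agree on all vertices except possibly $\vec1$ are equal. A nilspace of order $s$ is a fibrant cubespace for which $s\ge0$ is the smallest integer such that it has $(s+1)$-uniqueness; it is of order at most $d$ if $s\le d$. *)

theory Defs
  imports "HOL-Analysis.Analysis" "HOL-Algebra.Group_Action"
    "HOL-Algebra.Generated_Groups" "HOL-Algebra.Product_Groups"
begin

(* HOL-Algebra's prefix closure_of clashes with the topological X closure_of S. *)
no_notation eq_closure_of (\<open>closure'_of\<index>\<close>)

section \<open>Topological dynamical systems\<close>

definition topological_group :: "('g, 'm) monoid_scheme \<Rightarrow> 'g topology \<Rightarrow> bool" where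
  "topological_group G T \<longleftrightarrow>
     group G \<and> topspace T = carrier G \<and>
     continuous_map (prod_topology T T) T (\<lambda>(g, h). g \<otimes>\<^bsub>G\<^esub> h) \<and>
     continuous_map T T (\<lambda>g. inv\<^bsub>G\<^esub> g)"

text \<open>Being a group action makes each \<open>act g\<close> (with \<open>g\<close> in the carrier) an extensional
  bijection of the space, i.e. it is \<open>undefined\<close> outside it.\<close>

definition tds ::
  "('g, 'm) monoid_scheme \<Rightarrow> 'g topology \<Rightarrow> 'a topology \<Rightarrow> ('g \<Rightarrow> 'a \<Rightarrow> 'a) \<Rightarrow> bool" where
  "tds G T X act \<longleftrightarrow>
     topological_group G T \<and> Hausdorff_space T \<and>
     compact_space X \<and> Hausdorff_space X \<and>
     group_action G (topspace X) act \<and>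
     continuous_map (prod_topology T X) X (\<lambda>(g, x). act g x)"

definition minimal_tds ::
  "('g, 'm) monoid_scheme \<Rightarrow> 'g topology \<Rightarrow> 'a topology \<Rightarrow> ('g \<Rightarrow> 'a \<Rightarrow> 'a) \<Rightarrow> bool" where
  "minimal_tds G T X act \<longleftrightarrow>
     tds G T X act \<and> (\<forall>x\<in>topspace X. X closure_of (orbit G act x) = topspace X)"

definition factor_map ::
  "('g, 'm) monoid_scheme \<Rightarrow> 'g topology \<Rightarrow> 'a topology \<Rightarrow> ('g \<Rightarrow> 'a \<Rightarrow> 'a) \<Rightarrow>
     'b topology \<Rightarrow> ('g \<Rightarrow> 'b \<Rightarrow> 'b) \<Rightarrow> ('a \<Rightarrow> 'b) \<Rightarrow> bool" where
  "factor_map G T X actX Y actY \<phi> \<longleftrightarrow>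
     tds G T X actX \<and> tds G T Y actY \<and>
     continuous_map X Y \<phi> \<and> \<phi> ` topspace X = topspace Y \<and>
     (\<forall>g\<in>carrier G. \<forall>x\<in>topspace X. \<phi> (actX g x) = actY g (\<phi> x))"

section \<open>Discrete cubes and configurations\<close>

definition dcube :: "nat \<Rightarrow> (nat \<Rightarrow> nat) set" where
  "dcube d = ({1..d} \<rightarrow>\<^sub>E {0, 1})"

definition top_vertex :: "nat \<Rightarrow> nat \<Rightarrow> nat" where
  "top_vertex d = (\<lambda>i\<in>{1..d}. 1)"

definition hyperfaces :: "nat \<Rightarrow> (nat \<Rightarrow> nat) set set" where
  "hyperfaces d = {{\<omega> \<in> dcube d. \<omega> i = a} | i a. i \<in> {1..d} \<and> a \<in> {0, 1}}"

text \<open>The space of all maps from the discrete \<open>d\<close>-cube to \<open>X\<close>, represented as extensional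
  functions.\<close>

definition cube_power :: "'a topology \<Rightarrow> nat \<Rightarrow> ((nat \<Rightarrow> nat) \<Rightarrow> 'a) topology" where
  "cube_power X d = product_topology (\<lambda>_. X) (dcube d)"

definition cube_morphism :: "nat \<Rightarrow> nat \<Rightarrow> ((nat \<Rightarrow> nat) \<Rightarrow> nat \<Rightarrow> nat) \<Rightarrow> bool" where
  "cube_morphism d k f \<longleftrightarrow>
     f \<in> dcube d \<rightarrow> dcube k \<and>
     (\<forall>j\<in>{1..k}.
        (\<forall>\<omega>\<in>dcube d. f \<omega> j = 0) \<or>
        (\<forall>\<omega>\<in>dcube d. f \<omega> j = 1) \<or>
        (\<exists>i\<in>{1..d}. \<forall>\<omega>\<in>dcube d. f \<omega> j = \<omega> i) \<or>
        (\<exists>i\<in>{1..d}. \<forall>\<omega>\<in>dcube d. f \<omega> j = 1 - \<omega> i))"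

text \<open>The identification of the discrete \<open>(d - 1)\<close>-cube with the face \<open>\<omega> i = 0\<close> of the
  discrete \<open>d\<close>-cube: insert a \<open>0\<close> at position \<open>i\<close>.\<close>

definition face_incl :: "nat \<Rightarrow> nat \<Rightarrow> (nat \<Rightarrow> nat) \<Rightarrow> nat \<Rightarrow> nat" where
  "face_incl d i \<omega> = (\<lambda>j\<in>{1..d}. if j < i then \<omega> j else if j = i then 0 else \<omega> (j - 1))"

section \<open>Cubespaces and nilspaces\<close>

text \<open>Throughout, \<open>C d\<close> is the set of \<open>d\<close>-cubes of a cubespace on \<open>X\<close>.\<close>

definition cubespace :: "'a topology \<Rightarrow> (nat \<Rightarrow> ((nat \<Rightarrow> nat) \<Rightarrow> 'a) set) \<Rightarrow> bool" where
  "cubespace X C \<longleftrightarrow>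
     compact_space X \<and> Hausdorff_space X \<and>
     (\<forall>d. closedin (cube_power X d) (C d)) \<and>
     (\<forall>d k f c. cube_morphism d k f \<and> c \<in> C k \<longrightarrow> compose (dcube d) c f \<in> C d)"

definition ergodic :: "'a topology \<Rightarrow> (nat \<Rightarrow> ((nat \<Rightarrow> nat) \<Rightarrow> 'a) set) \<Rightarrow> bool" where
  "ergodic X C \<longleftrightarrow> C 1 = topspace (cube_power X 1)"

definition corner ::
  "'a topology \<Rightarrow> (nat \<Rightarrow> ((nat \<Rightarrow> nat) \<Rightarrow> 'a) set) \<Rightarrow> nat \<Rightarrow> ((nat \<Rightarrow> nat) \<Rightarrow> 'a) \<Rightarrow> bool" where
  "corner X C d f \<longleftrightarrow>
     f \<in> (dcube d - {top_vertex d}) \<rightarrow>\<^sub>E topspace X \<and>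
     (\<forall>i\<in>{1..d}. (\<lambda>\<omega>\<in>dcube (d - 1). f (face_incl d i \<omega>)) \<in> C (d - 1))"

definition has_completion ::
  "'a topology \<Rightarrow> (nat \<Rightarrow> ((nat \<Rightarrow> nat) \<Rightarrow> 'a) set) \<Rightarrow> nat \<Rightarrow> bool" where
  "has_completion X C d \<longleftrightarrow>
     (\<forall>f. corner X C d f \<longrightarrow> (\<exists>c\<in>C d. restrict c (dcube d - {top_vertex d}) = f))"

definition fibrant :: "'a topology \<Rightarrow> (nat \<Rightarrow> ((nat \<Rightarrow> nat) \<Rightarrow> 'a) set) \<Rightarrow> bool" where
  "fibrant X C \<longleftrightarrow> cubespace X C \<and> (\<forall>d\<ge>1. has_completion X C d)"

definition has_uniqueness :: "(nat \<Rightarrow> ((nat \<Rightarrow> nat) \<Rightarrow> 'a) set) \<Rightarrow> nat \<Rightarrow> bool" where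
  "has_uniqueness C d \<longleftrightarrow>
     (\<forall>c\<in>C d. \<forall>c'\<in>C d. (\<forall>\<omega>\<in>dcube d - {top_vertex d}. c \<omega> = c' \<omega>) \<longrightarrow> c = c')"

definition nilspace_of_order ::
  "'a topology \<Rightarrow> (nat \<Rightarrow> ((nat \<Rightarrow> nat) \<Rightarrow> 'a) set) \<Rightarrow> nat \<Rightarrow> bool" where
  "nilspace_of_order X C s \<longleftrightarrow>
     fibrant X C \<and> has_uniqueness C (s + 1) \<and> (\<forall>t<s. \<not> has_uniqueness C (t + 1))"

definition nilspace_of_order_at_most ::
  "'a topology \<Rightarrow> (nat \<Rightarrow> ((nat \<Rightarrow> nat) \<Rightarrow> 'a) set) \<Rightarrow> nat \<Rightarrow> bool" where
  "nilspace_of_order_at_most X C d \<longleftrightarrow> (\<exists>s\<le>d. nilspace_of_order X C s)"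

section \<open>Host-Kra cubes, dynamical cubes and the relation NRP\<close>

definition face_element ::
  "('g, 'm) monoid_scheme \<Rightarrow> nat \<Rightarrow> 'g \<Rightarrow> (nat \<Rightarrow> nat) set \<Rightarrow> (nat \<Rightarrow> nat) \<Rightarrow> 'g" where
  "face_element G d h F = (\<lambda>\<omega>\<in>dcube d. if \<omega> \<in> F then h else \<one>\<^bsub>G\<^esub>)"

definition host_kra :: "('g, 'm) monoid_scheme \<Rightarrow> nat \<Rightarrow> ((nat \<Rightarrow> nat) \<Rightarrow> 'g) set" where
  "host_kra G d =
     generate (product_group (dcube d) (\<lambda>_. G))
       {face_element G d h F | h F. h \<in> carrier G \<and> F \<in> hyperfaces d}"

definition dyn_cubes ::
  "('g, 'm) monoid_scheme \<Rightarrow> 'a topology \<Rightarrow> ('g \<Rightarrow> 'a \<Rightarrow> 'a) \<Rightarrow> nat \<Rightarrow>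
     ((nat \<Rightarrow> nat) \<Rightarrow> 'a) set" where
  "dyn_cubes G X act d =
     cube_power X d closure_of
       {\<lambda>\<omega>\<in>dcube d. act (g \<omega>) x | g x. g \<in> host_kra G d \<and> x \<in> topspace X}"

definition lower_corner :: "nat \<Rightarrow> 'a \<Rightarrow> 'a \<Rightarrow> (nat \<Rightarrow> nat) \<Rightarrow> 'a" where
  "lower_corner d x y = (\<lambda>\<omega>\<in>dcube d. if \<omega> = top_vertex d then y else x)"

definition NRP ::
  "('g, 'm) monoid_scheme \<Rightarrow> 'a topology \<Rightarrow> ('g \<Rightarrow> 'a \<Rightarrow> 'a) \<Rightarrow> nat \<Rightarrow> ('a \<times> 'a) set" where
  "NRP G X act d =
     {(x, y) \<in> topspace X \<times> topspace X. lower_corner (d + 1) x y \<in> dyn_cubes G X act (d + 1)}"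

section \<open>Quotient systems\<close>

text \<open>These are the usual quotient objects when \<open>R\<close> is an equivalence relation on the space
  (invariant under the action, for the action).\<close>

definition quot_proj :: "('a \<times> 'a) set \<Rightarrow> 'a \<Rightarrow> 'a set" where
  "quot_proj R x = R `` {x}"

definition quot_topology :: "'a topology \<Rightarrow> ('a \<times> 'a) set \<Rightarrow> 'a set topology" where
  "quot_topology X R =
     topology (\<lambda>U. U \<subseteq> topspace X // R \<and> openin X {x \<in> topspace X. quot_proj R x \<in> U})"

definition quot_action ::
  "'a topology \<Rightarrow> ('a \<times> 'a) set \<Rightarrow> ('g \<Rightarrow> 'a \<Rightarrow> 'a) \<Rightarrow> 'g \<Rightarrow> 'a set \<Rightarrow> 'a set" where
  "quot_action X R act g = (\<lambda>A\<in>topspace X // R. act g ` A)"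

lemma openin_quot_topology:
  "openin (quot_topology X R) U \<longleftrightarrow>
     U \<subseteq> topspace X // R \<and> openin X {x \<in> topspace X. quot_proj R x \<in> U}"
proof -
  let ?L = "\<lambda>U. U \<subseteq> topspace X // R \<and> openin X {x \<in> topspace X. quot_proj R x \<in> U}"
  have "?L (S \<inter> S')" if "?L S" "?L S'" for S S'
  proof -
    have "{x \<in> topspace X. quot_proj R x \<in> S \<inter> S'} =
        {x \<in> topspace X. quot_proj R x \<in> S} \<inter> {x \<in> topspace X. quot_proj R x \<in> S'}"
      by auto
    then show ?thesis
      using that by (auto intro: openin_Int)
  qed
  moreover have "?L (\<Union>K)" if "\<forall>S\<in>K. ?L S" for K
  proof -
    have "{x \<in> topspace X. quot_proj R x \<in> \<Union>K} =
        \<Union> ((\<lambda>S. {x \<in> topspace X. quot_proj R x \<in> S}) ` K)"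
      by auto
    moreover have "openin X (\<Union> ((\<lambda>S. {x \<in> topspace X. quot_proj R x \<in> S}) ` K))"
      using that by (intro openin_Union) auto
    ultimately show ?thesis
      using that by auto
  qed
  ultimately have "istopology ?L"
    unfolding istopology_def by blast
  then show ?thesis
    by (simp add: quot_topology_def)
qed

lemma topspace_quot_topology: "topspace (quot_topology X R) = topspace X // R"
proof -
  have "{x \<in> topspace X. quot_proj R x \<in> topspace X // R} = topspace X"
    by (auto simp: quot_proj_def quotient_def)
  then have "openin (quot_topology X R) (topspace X // R)"
    by (simp add: openin_quot_topology)
  then show ?thesis
    by (metis openin_quot_topology openin_subset openin_topspace subset_antisym)
qed

lemma quotient_map_quot_proj: "quotient_map X (quot_topology X R) (quot_proj R)"
  unfolding quotient_map_def topspace_quot_topology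
  by (auto simp: openin_quot_topology quot_proj_def quotient_def)

end

(* Let M be a minimal left ideal of the enveloping semigroup of X, u an idempotent of M and uM the
   corresponding group. M is itself a flow on which right translations act by automorphisms, so its
   dynamical cubes form a semigroup under pointwise composition, and those with entries in uM form
   a group closed under morphisms of discrete cubes. Such a group can be handled one vertex at a
   time, because precomposition with inf _ w turns a cube that is trivial strictly below w into one
   supported on an upper face. With K the group of those b in uM for which (u,...,u,b) is a cube of
   M, this gives (x,y) : NRP iff u y : K (u x), so NRP is an equivalence relation. In the quotient
   Q every idempotent acts as the identity, every cube of Q is the image of one with entries in uM,
   and the vertex by vertex argument yields completion in all dimensions and uniqueness in
   dimension d + 1. *)

theory Submission
  imports Defs
begin

text \<open>An element of the enveloping semigroup is a pointwise limit of homeomorphisms and may be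
  discontinuous, so it cannot be carried through a closure in the cube variable. This is why the
  work moves from X to M: there the product \<open>p \<star> q\<close> is continuous in p for fixed
  q, and this one-sided continuity drives the compactness arguments. The group u M need not be
  closed, so inverses of cubes are not obtained as limits but from idempotents in compact semigroups
  of cubes. The rest is algebra of cosets. Points of the quotient correspond to left cosets in u M
  of the stabilizer of a base point, so two lifts of the same configuration agree only modulo that
  stabilizer. The vertex by vertex argument absorbs this ambiguity with a correction cube whose
  entries all lie in the stabilizer. In the uniqueness argument the dimension d + 1 enters through a
  single fact: K in that dimension fixes every point of the quotient.\<close>

section \<open>Compact semigroups\<close>

text \<open>Compactness keeps the intersection of a chain of nonempty closed sets nonempty, so
  Zorn's lemma applies. It is run on complements because \<open>subset_Zorn_nonempty\<close> yields
  maximal sets.\<close>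

lemma minimal_closed_set:
  assumes "compact_space Z" and ne: "\<A> \<noteq> {}"
    and clo: "\<And>S. S \<in> \<A> \<Longrightarrow> closedin Z S \<and> S \<noteq> {}"
    and Inter: "\<And>\<C>. \<lbrakk>\<C> \<noteq> {}; \<C> \<subseteq> \<A>; \<Inter>\<C> \<noteq> {}\<rbrakk> \<Longrightarrow> \<Inter>\<C> \<in> \<A>"
  obtains S where "S \<in> \<A>" "\<And>S'. \<lbrakk>S' \<in> \<A>; S' \<subseteq> S\<rbrakk> \<Longrightarrow> S' = S"
proof -
  have Un: "\<Union>\<C> \<in> uminus ` \<A>" if "\<C> \<noteq> {}" and ch: "subset.chain (uminus ` \<A>) \<C>" for \<C>
  proof -
    define \<D> where "\<D> = uminus ` \<C>"
    have sub: "\<C> \<subseteq> uminus ` \<A>" and tot: "\<And>A B. A \<in> \<C> \<Longrightarrow> B \<in> \<C> \<Longrightarrow> A \<subseteq> B \<or> B \<subseteq> A"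
      using ch by (auto simp: subset_chain_def)
    have "\<D> \<subseteq> \<A>" "\<D> \<noteq> {}"
      using sub \<open>\<C> \<noteq> {}\<close> by (auto simp: \<D>_def)
    have totD: "A \<subseteq> B \<or> B \<subseteq> A" if "A \<in> \<D>" "B \<in> \<D>" for A B
      using tot that by (force simp: \<D>_def)
    \<comment> \<open>In a chain every finite intersection contains a member, so the finite
      intersection property reduces to nonemptiness of the members.\<close>
    have fin: "\<exists>A\<in>\<D>. A \<subseteq> \<Inter>\<F>" if "finite \<F>" "\<F> \<subseteq> \<D>" for \<F>
      using that
    proof (induction \<F>)
      case empty
      then show ?case using \<open>\<D> \<noteq> {}\<close> by auto
    next
      case (insert F \<F>)
      then obtain A where "A \<in> \<D>" "A \<subseteq> \<Inter>\<F>" by auto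
      then show ?case
        using totD[of A F] insert.prems by (auto 4 4)
    qed
    have "\<Inter>\<F> \<noteq> {}" if F: "finite \<F>" "\<F> \<subseteq> \<D>" for \<F>
    proof -
      obtain A where A: "A \<in> \<D>" "A \<subseteq> \<Inter>\<F>"
        using fin[OF F] by blast
      with \<open>\<D> \<subseteq> \<A>\<close> clo show ?thesis by blast
    qed
    moreover have "\<forall>C\<in>\<D>. closedin Z C"
      using clo \<open>\<D> \<subseteq> \<A>\<close> by blast
    ultimately have "\<Inter>\<D> \<noteq> {}"
      using iffD1[OF compact_space_fip \<open>compact_space Z\<close>] by simp
    then have "\<Inter>\<D> \<in> \<A>"
      using Inter \<open>\<D> \<subseteq> \<A>\<close> \<open>\<D> \<noteq> {}\<close> by blast
    moreover have "\<Union>\<C> = - \<Inter>\<D>"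
      by (auto simp: \<D>_def)
    ultimately show ?thesis by blast
  qed
  have "\<exists>M\<in>uminus ` \<A>. \<forall>X\<in>uminus ` \<A>. M \<subseteq> X \<longrightarrow> X = M"
  proof (rule subset_Zorn_nonempty)
    show "uminus ` \<A> \<noteq> {}"
      using ne by blast
  next
    fix \<C> assume "\<C> \<noteq> {}" "subset.chain (uminus ` \<A>) \<C>"
    then show "\<Union>\<C> \<in> uminus ` \<A>" by (rule Un)
  qed
  then obtain M where "M \<in> uminus ` \<A>" and M: "\<forall>X\<in>uminus ` \<A>. M \<subseteq> X \<longrightarrow> X = M" ..
  then obtain S where "S \<in> \<A>" "M = - S" by auto
  have "S' = S" if "S' \<in> \<A>" "S' \<subseteq> S" for S'
    using bspec[OF M, of "- S'"] that \<open>M = - S\<close> by auto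
  with \<open>S \<in> \<A>\<close> show thesis by (rule that)
qed

text \<open>The Ellis-Numakura lemma. In a minimal closed subsemigroup A the set A v is again a
  closed subsemigroup, hence equals A; so some w has w v = v, and the closed subsemigroup of all
  such w is A as well. In particular v v = v.\<close>

lemma idempotent_exists:
  fixes m :: "'a \<Rightarrow> 'a \<Rightarrow> 'a"
  assumes comp: "compact_space Z" and haus: "Hausdorff_space Z"
    and "closedin Z S" "S \<noteq> {}"
    and S: "\<And>x y. \<lbrakk>x \<in> S; y \<in> S\<rbrakk> \<Longrightarrow> m x y \<in> S"
    and assoc: "\<And>x y z. \<lbrakk>x \<in> S; y \<in> S; z \<in> S\<rbrakk> \<Longrightarrow> m (m x y) z = m x (m y z)"
    and cont: "\<And>y. y \<in> S \<Longrightarrow> continuous_map Z Z (\<lambda>x. m x y)"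
  obtains v where "v \<in> S" "m v v = v"
proof -
  define \<A> where "\<A> = {A. closedin Z A \<and> A \<noteq> {} \<and> A \<subseteq> S \<and> (\<forall>x\<in>A. \<forall>y\<in>A. m x y \<in> A)}"
  have "S \<in> \<A>"
    using assms by (auto simp: \<A>_def)
  have "\<Inter>\<C> \<in> \<A>" if "\<C> \<noteq> {}" "\<C> \<subseteq> \<A>" "\<Inter>\<C> \<noteq> {}" for \<C>
  proof -
    have "closedin Z (\<Inter>\<C>)"
      using that by (intro closedin_Inter) (auto simp: \<A>_def)
    moreover have "\<Inter>\<C> \<subseteq> S"
      using \<open>\<C> \<noteq> {}\<close> \<open>\<C> \<subseteq> \<A>\<close> by (force simp: \<A>_def)
    moreover have "m x y \<in> \<Inter>\<C>" if xy: "x \<in> \<Inter>\<C>" "y \<in> \<Inter>\<C>" for x y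
      using xy \<open>\<C> \<subseteq> \<A>\<close> by (force simp: \<A>_def)
    ultimately show ?thesis
      using \<open>\<Inter>\<C> \<noteq> {}\<close> by (simp add: \<A>_def)
  qed
  note Inter = this
  obtain A where A: "A \<in> \<A>" and min: "\<And>A'. \<lbrakk>A' \<in> \<A>; A' \<subseteq> A\<rbrakk> \<Longrightarrow> A' = A"
  proof (rule minimal_closed_set[OF comp, of \<A>])
    show "\<A> \<noteq> {}" using \<open>S \<in> \<A>\<close> by blast
    show "closedin Z S \<and> S \<noteq> {}" if "S \<in> \<A>" for S
      using that by (simp add: \<A>_def)
  qed (use Inter in auto)
  have clA: "closedin Z A" and AS: "A \<subseteq> S" and mA: "\<And>x y. x \<in> A \<Longrightarrow> y \<in> A \<Longrightarrow> m x y \<in> A"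
    using A by (auto simp: \<A>_def)
  obtain v where v: "v \<in> A" using A by (auto simp: \<A>_def)
  have "v \<in> S" using v AS by blast
  have "closedin Z ((\<lambda>x. m x v) ` A)"
    by (intro compactin_imp_closedin[OF haus] image_compactin[OF _ cont[OF \<open>v \<in> S\<close>]]
        closedin_compact_space[OF comp clA])
  moreover have "m (m x v) (m y v) \<in> (\<lambda>x. m x v) ` A" if "x \<in> A" "y \<in> A" for x y
  proof -
    have "x \<in> S" "y \<in> S" "m x v \<in> S"
      using that v AS mA by blast+
    then have "m (m x v) (m y v) = m (m (m x v) y) v"
      using assoc[of "m x v" y v] \<open>v \<in> S\<close> by simp
    then show ?thesis using that v mA by blast
  qed
  ultimately have "(\<lambda>x. m x v) ` A \<in> \<A>"
    using v AS mA by (auto simp: \<A>_def)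
  moreover have "(\<lambda>x. m x v) ` A \<subseteq> A"
    using mA v by blast
  ultimately have "(\<lambda>x. m x v) ` A = A"
    by (rule min)
  then have "v \<in> (\<lambda>x. m x v) ` A"
    using v by (simp only:)
  then obtain w where w: "w \<in> A" "v = m w v" by (rule imageE)
  define B where "B = {x \<in> A. m x v = v}"
  have "closedin Z {v}"
    using closedin_subset[OF clA] v by (simp add: closedin_Hausdorff_sing_eq[OF haus] subset_iff)
  then have "closedin Z {x \<in> topspace Z. m x v \<in> {v}}"
    by (rule closedin_continuous_map_preimage[OF cont[OF \<open>v \<in> S\<close>]])
  then have "closedin Z (A \<inter> {x \<in> topspace Z. m x v \<in> {v}})"
    by (rule closedin_Int[OF clA])
  moreover have "A \<inter> {x \<in> topspace Z. m x v \<in> {v}} = B"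
    using closedin_subset[OF clA] by (auto simp: B_def)
  ultimately have "closedin Z B" by simp
  moreover have "m x y \<in> B" if "x \<in> B" "y \<in> B" for x y
  proof -
    have "x \<in> A" "y \<in> A" "m x v = v" "m y v = v" "x \<in> S" "y \<in> S"
      using that AS by (auto simp: B_def)
    then have "m (m x y) v = v"
      using assoc[of x y v] \<open>v \<in> S\<close> by simp
    then show ?thesis
      using mA[OF \<open>x \<in> A\<close> \<open>y \<in> A\<close>] by (simp add: B_def)
  qed
  ultimately have "B \<in> \<A>"
    using w(1) w(2)[symmetric] AS by (auto simp: \<A>_def B_def)
  moreover have "B \<subseteq> A" by (auto simp: B_def)
  ultimately have "B = A" by (rule min)
  then have "v \<in> B" using v by simp
  then have "m v v = v" by (simp add: B_def)
  with \<open>v \<in> S\<close> show thesis by (rule that)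
qed

section \<open>Groups of cubes\<close>

lemma finite_dcube: "finite (dcube n)"
  by (simp add: dcube_def finite_PiE)

lemma top_vertex_dcube: "top_vertex n \<in> dcube n"
  by (auto simp: top_vertex_def dcube_def)

text \<open>Outside \<open>{1..n}\<close> both functions are \<open>undefined\<close>, and so is
  their meet, by idempotence of \<open>inf\<close>.\<close>

lemma inf_dcube: "\<omega> \<in> dcube n \<Longrightarrow> \<omega>' \<in> dcube n \<Longrightarrow> inf \<omega> \<omega>' \<in> dcube n"
  by (fastforce simp: dcube_def PiE_iff extensional_def inf_nat_def)

lemma inf_less2: "\<not> \<omega> \<le> \<omega>' \<Longrightarrow> inf \<omega>' \<omega> < \<omega>" for \<omega> \<omega>' :: "nat \<Rightarrow> nat"
  by (metis inf_le1 inf_le2 order.not_eq_order_implies_strict)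

lemma le_top_vertex: "\<omega> \<in> dcube n \<Longrightarrow> \<omega> \<le> top_vertex n"
  by (force simp: dcube_def top_vertex_def le_fun_def PiE_iff extensional_def)

text \<open>Meeting with \<open>\<omega>\<close> clears the coordinates in which
  \<open>\<omega>\<close> is 0 and keeps the others: it retracts the cube onto the face of vertices
  below \<open>\<omega>\<close>.\<close>

lemma cube_morphism_inf:
  assumes "\<omega> \<in> dcube n"
  shows "cube_morphism n n (\<lambda>\<omega>'. inf \<omega>' \<omega>)"
proof -
  have "(\<forall>\<omega>'\<in>dcube n. inf \<omega>' \<omega> j = 0) \<or> (\<forall>\<omega>'\<in>dcube n. inf \<omega>' \<omega> j = \<omega>' j)"
    if "j \<in> {1..n}" for j
  proof -
    have *: "\<omega>' j = 0 \<or> \<omega>' j = 1" if "\<omega>' \<in> dcube n" for \<omega>'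
      using that \<open>j \<in> {1..n}\<close> by (auto simp: dcube_def)
    from *[OF assms] show ?thesis
    proof (elim disjE)
      assume "\<omega> j = 1"
      then have "inf \<omega>' \<omega> j = \<omega>' j" if "\<omega>' \<in> dcube n" for \<omega>'
        using *[OF that] by (auto simp: inf_nat_def)
      then show ?thesis by blast
    qed (simp add: inf_nat_def)
  qed
  then show ?thesis
    unfolding cube_morphism_def using assms inf_dcube by blast
qed

definition down_closed :: "nat \<Rightarrow> (nat \<Rightarrow> nat) set \<Rightarrow> bool" where
  "down_closed n P \<longleftrightarrow> P \<subseteq> dcube n \<and> (\<forall>\<omega>\<in>P. \<forall>\<omega>'\<in>dcube n. \<omega>' \<le> \<omega> \<longrightarrow> \<omega>' \<in> P)"

lemma down_closed_proper: "down_closed n (dcube n - {top_vertex n})"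
  using le_top_vertex by (auto simp: down_closed_def intro: antisym)

lemma down_closed_strictly_below: "down_closed n {\<omega>' \<in> dcube n. \<omega>' < \<omega>}"
  by (auto simp: down_closed_def)

text \<open>Take off a maximal vertex. In the step no vertex of P lies above
  \<open>\<omega>\<close>, so a change confined to the upper face of \<open>\<omega>\<close> leaves
  P untouched, while everything strictly below \<open>\<omega>\<close> has already been
  treated.\<close>

lemma down_closed_induct [consumes 1, case_names empty insert]:
  assumes "down_closed n P" and "Q {}"
    and step: "\<And>P \<omega>. \<lbrakk>P \<subseteq> dcube n; \<omega> \<in> dcube n; \<And>\<omega>'. \<omega>' \<in> P \<Longrightarrow> \<not> \<omega> \<le> \<omega>';
         \<And>\<omega>'. \<lbrakk>\<omega>' \<in> dcube n; \<omega>' < \<omega>\<rbrakk> \<Longrightarrow> \<omega>' \<in> P; Q P\<rbrakk> \<Longrightarrow> Q (insert \<omega> P)"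
  shows "Q P"
proof -
  have "finite P"
    using assms(1) finite_dcube finite_subset by (auto simp: down_closed_def)
  then show ?thesis
    using assms(1)
  proof (induction P rule: finite_psubset_induct)
    case (psubset P)
    have sub: "P \<subseteq> dcube n"
      and down: "\<And>\<omega> \<omega>'. \<lbrakk>\<omega> \<in> P; \<omega>' \<in> dcube n; \<omega>' \<le> \<omega>\<rbrakk> \<Longrightarrow> \<omega>' \<in> P"
      using psubset.prems by (auto simp: down_closed_def)
    show ?case
    proof (cases "P = {}")
      case True
      then show ?thesis using \<open>Q {}\<close> by simp
    next
      case False
      then obtain \<omega> where \<omega>: "\<omega> \<in> P" and max: "\<And>\<omega>'. \<lbrakk>\<omega>' \<in> P; \<omega> \<le> \<omega>'\<rbrakk> \<Longrightarrow> \<omega> = \<omega>'"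
        using finite_has_maximal[OF psubset.hyps] by blast
      have "Q (insert \<omega> (P - {\<omega>}))"
      proof (rule step)
        show "Q (P - {\<omega>})"
        proof (rule psubset.IH)
          have "\<omega>' \<in> P - {\<omega>}" if "\<omega>'' \<in> P - {\<omega>}" "\<omega>' \<in> dcube n" "\<omega>' \<le> \<omega>''" for \<omega>' \<omega>''
            using that down[of \<omega>'' \<omega>'] max[of \<omega>''] by auto
          then show "down_closed n (P - {\<omega>})"
            using sub unfolding down_closed_def by blast
        qed (use \<omega> in auto)
        show "\<not> \<omega> \<le> \<omega>'" if "\<omega>' \<in> P - {\<omega>}" for \<omega>'
          using max[of \<omega>'] that by auto
        show "\<omega>' \<in> P - {\<omega>}" if "\<omega>' \<in> dcube n" "\<omega>' < \<omega>" for \<omega>'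
          using down[OF \<omega>] that by auto
      qed (use \<omega> sub in auto)
      then show ?thesis
        using \<omega> by (simp add: insert_absorb)
    qed
  qed
qed

text \<open>Abstracts the cubes with entries in u M, without topology. The dimension n stays fixed,
  since the vertex by vertex argument never leaves it.\<close>

locale cube_group = group G for G (structure) +
  fixes n :: nat and CC :: "((nat \<Rightarrow> nat) \<Rightarrow> 'a) set"
  assumes cubes_carrier: "a \<in> CC \<Longrightarrow> a \<in> dcube n \<rightarrow>\<^sub>E carrier G"
    and one_cubes: "(\<lambda>\<omega>\<in>dcube n. \<one>) \<in> CC"
    and mult_cubes: "\<lbrakk>a \<in> CC; b \<in> CC\<rbrakk> \<Longrightarrow> (\<lambda>\<omega>\<in>dcube n. a \<omega> \<otimes> b \<omega>) \<in> CC"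
    and inv_cubes: "a \<in> CC \<Longrightarrow> (\<lambda>\<omega>\<in>dcube n. inv (a \<omega>)) \<in> CC"
    and inf_cubes: "\<lbrakk>a \<in> CC; \<omega> \<in> dcube n\<rbrakk> \<Longrightarrow> (\<lambda>\<omega>'\<in>dcube n. a (inf \<omega>' \<omega>)) \<in> CC"
begin

lemma cubes_closed [simp]: "a \<in> CC \<Longrightarrow> \<omega> \<in> dcube n \<Longrightarrow> a \<omega> \<in> carrier G"
  using cubes_carrier by (auto simp: PiE_iff)

text \<open>As t is H-valued at all vertices, multiplying by it on the right changes no left coset
  of H, yet it makes e trivial on P. Inductively, the remaining error
  \<open>e \<omega> \<otimes> t \<omega>\<close> is spread over the upper face of
  \<open>\<omega>\<close> and divided out; it lies in H because both factors do.\<close>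

lemma cube_trivialize:
  assumes H: "subgroup H G" and e: "e \<in> CC"
    and P: "down_closed n P"
    and eH: "\<And>\<omega>. \<omega> \<in> P \<Longrightarrow> e \<omega> \<in> H"
  shows "\<exists>t\<in>CC. (\<forall>\<omega>\<in>dcube n. t \<omega> \<in> H) \<and> (\<forall>\<omega>\<in>P. e \<omega> \<otimes> t \<omega> = \<one>)"
  using P eH
proof (induction P rule: down_closed_induct)
  case empty
  show ?case
    using subgroup.one_closed[OF H] by (intro bexI[OF _ one_cubes]) simp
next
  case (insert P \<omega>)
  note \<omega> = \<open>\<omega> \<in> dcube n\<close>
  have "\<And>\<omega>. \<omega> \<in> P \<Longrightarrow> e \<omega> \<in> H"
    using insert.prems by simp
  then obtain t where t: "t \<in> CC" "\<And>\<omega>. \<omega> \<in> dcube n \<Longrightarrow> t \<omega> \<in> H" "\<And>\<omega>. \<omega> \<in> P \<Longrightarrow> e \<omega> \<otimes> t \<omega> = \<one>"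
    using insert.IH by blast
  \<comment> \<open>k is trivial off the upper face of \<open>\<omega>\<close> (\<open>k1\<close>)
    and constantly \<open>e \<omega> \<otimes> t \<omega>\<close> on it (\<open>k2\<close>).\<close>
  define k where "k = (\<lambda>\<omega>'\<in>dcube n. e (inf \<omega>' \<omega>) \<otimes> t (inf \<omega>' \<omega>))"
  have "k = (\<lambda>\<omega>'\<in>dcube n. (\<lambda>\<omega>\<in>dcube n. e \<omega> \<otimes> t \<omega>) (inf \<omega>' \<omega>))"
    by (auto simp: k_def fun_eq_iff restrict_def inf_dcube \<omega>)
  then have "k \<in> CC"
    using inf_cubes[OF mult_cubes[OF e t(1)] \<omega>] by simp
  have k1: "k \<omega>' = \<one>" if "\<omega>' \<in> dcube n" "\<not> \<omega> \<le> \<omega>'" for \<omega>'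
  proof -
    have "inf \<omega>' \<omega> \<in> P"
      using that \<omega> by (intro insert) (auto simp: inf_dcube inf_less2)
    then show ?thesis
      using that by (simp add: k_def t)
  qed
  have k2: "k \<omega>' = e \<omega> \<otimes> t \<omega>" if "\<omega>' \<in> dcube n" "\<omega> \<le> \<omega>'" for \<omega>'
    using that by (simp add: k_def inf_absorb2)
  have "e \<omega> \<in> H"
    using insert.prems by simp
  then have kH: "k \<omega>' \<in> H" if "\<omega>' \<in> dcube n" for \<omega>'
    using k1[OF that] k2[OF that] t(2)[OF \<omega>] H
    by (cases "\<omega> \<le> \<omega>'") (simp_all add: subgroup.m_closed subgroup.one_closed)
  define s where "s = (\<lambda>\<omega>\<in>dcube n. t \<omega> \<otimes> inv (k \<omega>))"
  have "s = (\<lambda>\<omega>\<in>dcube n. t \<omega> \<otimes> (\<lambda>\<omega>\<in>dcube n. inv (k \<omega>)) \<omega>)"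
    by (auto simp: s_def)
  then have "s \<in> CC"
    using mult_cubes[OF t(1) inv_cubes[OF \<open>k \<in> CC\<close>]] by simp
  moreover have "s \<omega>' \<in> H" if "\<omega>' \<in> dcube n" for \<omega>'
    using that t(2) kH H by (simp add: s_def subgroup.m_closed subgroup.m_inv_closed)
  moreover have "e \<omega>' \<otimes> s \<omega>' = \<one>" if "\<omega>' \<in> insert \<omega> P" for \<omega>'
  proof (cases "\<omega>' = \<omega>")
    case True
    have "e \<omega> \<otimes> s \<omega> = (e \<omega> \<otimes> t \<omega>) \<otimes> inv (e \<omega> \<otimes> t \<omega>)"
      using \<omega> e t(1) \<open>k \<in> CC\<close> by (simp add: s_def k2 m_assoc[symmetric])
    then show ?thesis
      using True \<omega> e t(1) by simp
  next
    case False
    then have "\<omega>' \<in> P" "\<omega>' \<in> dcube n"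
      using that insert.hyps by auto
    then show ?thesis
      using insert.hyps e t k1 by (simp add: s_def)
  qed
  ultimately show ?case
    by (intro bexI[of _ s]) auto
qed

text \<open>The fibres of \<open>val\<close> are the left cosets of H. A cube that lifts f below
  \<open>\<omega>\<close> agrees with the lift found so far only modulo H, so it cannot be glued on
  directly; \<open>cube_trivialize\<close> makes the discrepancy exactly trivial strictly below
  \<open>\<omega>\<close>, and then it can be pushed to the upper face. The premise on f is what a
  corner provides, because each vertex other than the top one lies in a lower face.\<close>

lemma cube_completion:
  assumes H: "subgroup H G"
    and val: "\<And>a b. \<lbrakk>a \<in> carrier G; b \<in> carrier G\<rbrakk> \<Longrightarrow> val a = val b \<longleftrightarrow> inv a \<otimes> b \<in> H"
    and f: "\<And>\<omega>. \<lbrakk>\<omega> \<in> dcube n; \<omega> \<noteq> top_vertex n\<rbrakk> \<Longrightarrow>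
              \<exists>b\<in>CC. \<forall>\<omega>'\<in>dcube n. val (b \<omega>') = f (inf \<omega>' \<omega>)"
  shows "\<exists>a\<in>CC. \<forall>\<omega>\<in>dcube n - {top_vertex n}. val (a \<omega>) = f \<omega>"
proof -
  \<comment> \<open>Named so that the induction ranges over down-closed sets avoiding the top
    vertex, where nothing is prescribed.\<close>
  define P where "P = dcube n - {top_vertex n}"
  have "down_closed n P"
    unfolding P_def by (rule down_closed_proper)
  moreover have "top_vertex n \<notin> P"
    by (simp add: P_def)
  ultimately have "\<exists>a\<in>CC. \<forall>\<omega>\<in>P. val (a \<omega>) = f \<omega>"
  proof (induction P rule: down_closed_induct)
    case empty
    then show ?case using one_cubes by auto
  next
    case (insert R \<omega>)
    note \<omega> = \<open>\<omega> \<in> dcube n\<close>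
    from insert obtain a where a: "a \<in> CC" "\<And>\<omega>'. \<omega>' \<in> R \<Longrightarrow> val (a \<omega>') = f \<omega>'"
      by auto
    have "\<omega> \<noteq> top_vertex n"
      using insert.prems by auto
    then obtain b where b: "b \<in> CC" "\<And>\<omega>'. \<omega>' \<in> dcube n \<Longrightarrow> val (b \<omega>') = f (inf \<omega>' \<omega>)"
      using f[OF \<omega>] by auto
    \<comment> \<open>The discrepancy of the two lifts; it lies in H strictly below
      \<open>\<omega>\<close>, where both lift f.\<close>
    define e where "e = (\<lambda>\<omega>'\<in>dcube n. inv (a \<omega>') \<otimes> b \<omega>')"
    have "e = (\<lambda>\<omega>'\<in>dcube n. (\<lambda>\<omega>\<in>dcube n. inv (a \<omega>)) \<omega>' \<otimes> b \<omega>')"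
      by (auto simp: e_def)
    then have e: "e \<in> CC"
      using mult_cubes[OF inv_cubes[OF a(1)] b(1)] by simp
    have "\<exists>t\<in>CC. (\<forall>\<omega>\<in>dcube n. t \<omega> \<in> H) \<and>
        (\<forall>\<omega>'\<in>{\<omega>' \<in> dcube n. \<omega>' < \<omega>}. e \<omega>' \<otimes> t \<omega>' = \<one>)"
    proof (rule cube_trivialize[OF H e])
      show "e \<omega>' \<in> H" if "\<omega>' \<in> {\<omega>' \<in> dcube n. \<omega>' < \<omega>}" for \<omega>'
      proof -
        have "\<omega>' \<in> R" "\<omega>' \<in> dcube n" "inf \<omega>' \<omega> = \<omega>'"
          using that insert.hyps by (auto simp: inf_absorb1)
        then have "val (a \<omega>') = val (b \<omega>')"
          using a(2) b(2) by simp
        then show ?thesis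
          using \<open>\<omega>' \<in> dcube n\<close> a(1) b(1) val by (simp add: e_def)
      qed
    qed (rule down_closed_strictly_below)
    then obtain t where t: "t \<in> CC" "\<And>\<omega>. \<omega> \<in> dcube n \<Longrightarrow> t \<omega> \<in> H"
      "\<And>\<omega>'. \<lbrakk>\<omega>' \<in> dcube n; \<omega>' < \<omega>\<rbrakk> \<Longrightarrow> e \<omega>' \<otimes> t \<omega>' = \<one>"
      by auto
    define k where "k = (\<lambda>\<omega>'\<in>dcube n. e (inf \<omega>' \<omega>) \<otimes> t (inf \<omega>' \<omega>))"
    have "k = (\<lambda>\<omega>'\<in>dcube n. (\<lambda>\<omega>\<in>dcube n. e \<omega> \<otimes> t \<omega>) (inf \<omega>' \<omega>))"
      by (auto simp: k_def fun_eq_iff restrict_def inf_dcube \<omega>)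
    then have "k \<in> CC"
      using inf_cubes[OF mult_cubes[OF e t(1)] \<omega>] by simp
    have k1: "k \<omega>' = \<one>" if "\<omega>' \<in> dcube n" "\<not> \<omega> \<le> \<omega>'" for \<omega>'
      using that \<omega> t(3)[of "inf \<omega>' \<omega>"] by (simp add: k_def inf_dcube inf_less2)
    \<comment> \<open>At \<open>\<omega>\<close> this equals
      \<open>b \<omega> \<otimes> t \<omega>\<close>, which is in the coset of
      \<open>b \<omega>\<close>; on R it equals a, since k is trivial there.\<close>
    define c where "c = (\<lambda>\<omega>\<in>dcube n. a \<omega> \<otimes> k \<omega>)"
    have "c \<in> CC"
      unfolding c_def by (rule mult_cubes[OF a(1) \<open>k \<in> CC\<close>])
    moreover have "val (c \<omega>') = f \<omega>'" if "\<omega>' \<in> insert \<omega> R" for \<omega>'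
    proof (cases "\<omega>' = \<omega>")
      case True
      have "c \<omega> = a \<omega> \<otimes> (inv (a \<omega>) \<otimes> b \<omega> \<otimes> t \<omega>)"
        using \<omega> by (simp add: c_def k_def e_def)
      also have "\<dots> = b \<omega> \<otimes> t \<omega>"
        using \<omega> a(1) b(1) t(1) by (simp add: m_assoc[symmetric])
      finally have "inv (b \<omega>) \<otimes> c \<omega> = t \<omega>"
        using \<omega> b(1) t(1) by (simp add: m_assoc[symmetric])
      then have "val (b \<omega>) = val (c \<omega>)"
        using \<omega> b(1) t(2) \<open>c \<in> CC\<close> by (simp add: val)
      then show ?thesis
        using b(2)[OF \<omega>] True by simp
    next
      case False
      then have "\<omega>' \<in> R" "\<omega>' \<in> dcube n"
        using that insert.hyps by auto
      then have "c \<omega>' = a \<omega>'"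
        using insert.hyps a(1) k1 by (simp add: c_def)
      then show ?thesis
        using a(2) \<open>\<omega>' \<in> R\<close> by simp
    qed
    ultimately show ?case by auto
  qed
  then show ?thesis by (simp add: P_def)
qed

end

section \<open>Host-Kra groups and dynamical cubes\<close>

lemma topspace_cube_power: "topspace (cube_power X n) = dcube n \<rightarrow>\<^sub>E topspace X"
  by (simp add: cube_power_def)

lemma compact_space_cube_power: "compact_space X \<Longrightarrow> compact_space (cube_power X n)"
  by (simp add: cube_power_def compact_space_product_topology)

lemma Hausdorff_space_cube_power: "Hausdorff_space X \<Longrightarrow> Hausdorff_space (cube_power X n)"
  by (simp add: cube_power_def Hausdorff_space_product_topology)

lemma continuous_map_cube_power:
  assumes "\<And>\<omega>. \<omega> \<in> dcube n \<Longrightarrow> continuous_map Z X (\<lambda>c. f c \<omega>)"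
  shows "continuous_map Z (cube_power X n) (\<lambda>c. \<lambda>\<omega>\<in>dcube n. f c \<omega>)"
  using assms by (auto simp: cube_power_def continuous_map_componentwise)

lemma continuous_map_cube_power_projection:
  "\<omega> \<in> dcube n \<Longrightarrow> continuous_map (cube_power X n) X (\<lambda>c. c \<omega>)"
  unfolding cube_power_def by (rule continuous_map_product_projection)

lemma dcube_0: "dcube 0 = {\<lambda>_. undefined}"
  by (simp add: dcube_def)

lemma hyperface_mem: "\<lbrakk>i \<in> {1..n}; a \<in> {0, 1}\<rbrakk> \<Longrightarrow> {\<omega> \<in> dcube n. \<omega> i = a} \<in> hyperfaces n"
  by (auto simp: hyperfaces_def)

lemma dcube_cases: "\<lbrakk>\<omega> \<in> dcube n; i \<in> {1..n}\<rbrakk> \<Longrightarrow> \<omega> i = 0 \<or> \<omega> i = 1"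
  by (auto simp: dcube_def)

lemma dcube_neq_top_vertex_iff:
  assumes "\<omega> \<in> dcube n"
  shows "\<omega> \<noteq> top_vertex n \<longleftrightarrow> (\<exists>i\<in>{1..n}. \<omega> i = 0)"
proof
  show "\<omega> \<noteq> top_vertex n" if "\<exists>i\<in>{1..n}. \<omega> i = 0"
    using that by (auto simp: top_vertex_def)
  show "\<exists>i\<in>{1..n}. \<omega> i = 0" if "\<omega> \<noteq> top_vertex n"
  proof (rule ccontr)
    assume "\<not> (\<exists>i\<in>{1..n}. \<omega> i = 0)"
    then have *: "\<omega> i \<noteq> 0" if "i \<in> {1..n}" for i
      using that by auto
    have "\<omega> i = top_vertex n i" for i
    proof (cases "i \<in> {1..n}")
      case True
      then show ?thesis
        using dcube_cases[OF assms True] *[OF True] by (simp add: top_vertex_def)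
    next
      case False
      then show ?thesis
        using assms by (auto simp: top_vertex_def dcube_def PiE_iff extensional_def)
    qed
    then show False using that by blast
  qed
qed

section \<open>Host-Kra groups and their pullbacks along morphisms of discrete cubes\<close>

context group
begin

lemma group_product_dcube: "group (product_group (dcube n) (\<lambda>_. G))"
  by (simp add: is_group)

lemma face_element_carrier:
  "h \<in> carrier G \<Longrightarrow> face_element G n h F \<in> dcube n \<rightarrow>\<^sub>E carrier G"
  by (auto simp: face_element_def)

lemma host_kra_one: "(\<lambda>\<omega>\<in>dcube n. \<one>) \<in> host_kra G n"
  using generate.one[of "product_group (dcube n) (\<lambda>_. G)"] by (simp add: host_kra_def)

lemma host_kra_mult:
  "\<lbrakk>a \<in> host_kra G n; b \<in> host_kra G n\<rbrakk> \<Longrightarrow> (\<lambda>\<omega>\<in>dcube n. a \<omega> \<otimes> b \<omega>) \<in> host_kra G n"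
  using generate.eng[of a "product_group (dcube n) (\<lambda>_. G)" _ b] by (simp add: host_kra_def)

lemma host_kra_face:
  "\<lbrakk>h \<in> carrier G; F \<in> hyperfaces n\<rbrakk> \<Longrightarrow> face_element G n h F \<in> host_kra G n"
  unfolding host_kra_def by (intro generate.incl) auto

lemma host_kra_carrier: "host_kra G n \<subseteq> dcube n \<rightarrow>\<^sub>E carrier G"
  unfolding host_kra_def
  using group.generate_incl[OF group_product_dcube, of "{face_element G n h F |h F. h \<in> carrier G \<and> F \<in> hyperfaces n}" n]
    face_element_carrier by fastforce

lemma host_kra_closed [simp]: "\<lbrakk>a \<in> host_kra G n; \<omega> \<in> dcube n\<rbrakk> \<Longrightarrow> a \<omega> \<in> carrier G"
  using host_kra_carrier by (auto simp: PiE_iff)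

text \<open>The inverse of a generator is the generator of the inverse element, so inverses need no
  case of their own.\<close>

lemma host_kra_induct [consumes 1, case_names one face mult]:
  assumes "a \<in> host_kra G n"
    and "Q (\<lambda>\<omega>\<in>dcube n. \<one>)"
    and face: "\<And>h F. \<lbrakk>h \<in> carrier G; F \<in> hyperfaces n\<rbrakk> \<Longrightarrow> Q (face_element G n h F)"
    and mult: "\<And>a b. \<lbrakk>a \<in> host_kra G n; b \<in> host_kra G n; Q a; Q b\<rbrakk> \<Longrightarrow> Q (\<lambda>\<omega>\<in>dcube n. a \<omega> \<otimes> b \<omega>)"
  shows "Q a"
  using assms(1) unfolding host_kra_def
proof (induction a rule: generate.induct)
  case one
  then show ?case using assms(2) by (simp del: restrict_apply)
next
  case (incl a)
  then show ?case using face by auto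
next
  case (inv a)
  then obtain h F where hF: "h \<in> carrier G" "F \<in> hyperfaces n" "a = face_element G n h F" by auto
  have "inv\<^bsub>product_group (dcube n) (\<lambda>_. G)\<^esub> a = face_element G n (inv h) F"
    using face_element_carrier[OF hF(1)] hF is_group
    by (subst inv_product_group) (auto simp: face_element_def)
  then show ?case using hF face by simp
next
  case (eng a b)
  then show ?case using mult by (simp add: host_kra_def del: restrict_apply)
qed

text \<open>Two opposite hyperfaces partition the cube. For n = 0 there are no hyperfaces and the
  Host-Kra group is trivial; this is the source of the assumption \<open>n \<ge> 1\<close> in later
  results that apply one element at all vertices.\<close>

lemma host_kra_whole:
  assumes "n \<ge> 1" "h \<in> carrier G"
  shows "face_element G n h (dcube n) \<in> host_kra G n"
proof -
  let ?F = "\<lambda>a. {\<omega> \<in> dcube n. \<omega> 1 = a}"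
  have "(\<lambda>\<omega>\<in>dcube n. face_element G n h (?F 0) \<omega> \<otimes> face_element G n h (?F 1) \<omega>) \<in> host_kra G n"
    using assms by (intro host_kra_mult host_kra_face hyperface_mem) auto
  moreover have "(\<lambda>\<omega>\<in>dcube n. face_element G n h (?F 0) \<omega> \<otimes> face_element G n h (?F 1) \<omega>)
      = face_element G n h (dcube n)"
    using assms dcube_cases[of _ n 1] by (force simp: face_element_def fun_eq_iff)
  ultimately show ?thesis by simp
qed

text \<open>The preimage of a hyperface under a morphism is empty, the whole cube or a hyperface, so
  a generator pulls back to the identity, a diagonal element or a generator.\<close>

lemma host_kra_compose:
  assumes "a \<in> host_kra G k" and f: "cube_morphism n k f" and "n \<ge> 1"
  shows "compose (dcube n) a f \<in> host_kra G n"
proof -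
  have fd: "f \<omega> \<in> dcube k" if "\<omega> \<in> dcube n" for \<omega>
    using f that by (auto simp: cube_morphism_def)
  show ?thesis
  using assms(1)
proof (induction a rule: host_kra_induct)
  case one
  have "compose (dcube n) (\<lambda>\<omega>\<in>dcube k. \<one>) f = (\<lambda>\<omega>\<in>dcube n. \<one>)"
    by (simp add: compose_def fd cong: restrict_cong)
  then show ?case using host_kra_one by (simp del: restrict_apply)
next
  case (face h F)
  then obtain i a where F: "F = {\<omega> \<in> dcube k. \<omega> i = a}" and i: "i \<in> {1..k}" and a: "a \<in> {0, 1}"
    by (auto simp: hyperfaces_def)
  define F' where "F' = {\<omega> \<in> dcube n. f \<omega> i = a}"
  have eq: "compose (dcube n) (face_element G k h F) f = face_element G n h F'"
    by (simp add: compose_def face_element_def fd F F'_def cong: restrict_cong)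
  consider "\<forall>\<omega>\<in>dcube n. f \<omega> i = 0" | "\<forall>\<omega>\<in>dcube n. f \<omega> i = 1"
    | j where "j \<in> {1..n}" "\<forall>\<omega>\<in>dcube n. f \<omega> i = \<omega> j"
    | j where "j \<in> {1..n}" "\<forall>\<omega>\<in>dcube n. f \<omega> i = 1 - \<omega> j"
    using f i unfolding cube_morphism_def by blast
  then have "F' = {} \<or> F' = dcube n \<or> F' \<in> hyperfaces n"
  proof cases
    case 3
    then have "F' = {\<omega> \<in> dcube n. \<omega> j = a}" by (auto simp: F'_def)
    then show ?thesis using hyperface_mem[OF 3(1) a] by simp
  next
    case 4
    have "f \<omega> i = a \<longleftrightarrow> \<omega> j = 1 - a" if "\<omega> \<in> dcube n" for \<omega>
      using dcube_cases[OF that 4(1)] a bspec[OF 4(2) that] by auto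
    then have "F' = {\<omega> \<in> dcube n. \<omega> j = 1 - a}"
      unfolding F'_def by (intro Collect_cong conj_cong refl)
    then show ?thesis using hyperface_mem[OF 4(1), of "1 - a"] a by auto
  qed (use a in \<open>auto simp: F'_def\<close>)
  moreover have "face_element G n h {} = (\<lambda>\<omega>\<in>dcube n. \<one>)"
    by (simp add: face_element_def)
  ultimately have "face_element G n h F' \<in> host_kra G n"
    using host_kra_one host_kra_whole[OF \<open>n \<ge> 1\<close> face(1)] host_kra_face[OF face(1)] by auto
  then show ?case by (simp add: eq)
next
  case (mult a b)
  have "compose (dcube n) (\<lambda>\<omega>\<in>dcube k. a \<omega> \<otimes> b \<omega>) f =
      (\<lambda>\<omega>\<in>dcube n. compose (dcube n) a f \<omega> \<otimes> compose (dcube n) b f \<omega>)"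
    by (simp add: compose_def fd cong: restrict_cong)
  then show ?case using host_kra_mult[OF mult.IH] by (simp del: restrict_apply)
qed
qed

end

text \<open>Asks for continuity of each \<open>act g\<close> separately and carries no topology on
  G, so that X, M and the quotient are instances on the same footing.\<close>

locale flow = group_action G "topspace X" act
  for G :: "('g, 'm) monoid_scheme" (structure) and X :: "'a topology" and act :: "'g \<Rightarrow> 'a \<Rightarrow> 'a" +
  assumes compact: "compact_space X" and Hausdorff: "Hausdorff_space X"
    and continuous_act: "g \<in> carrier G \<Longrightarrow> continuous_map X X (act g)"
begin

sublocale group G
  using group_hom by (rule group_hom.axioms(1))

abbreviation cubes :: "nat \<Rightarrow> ((nat \<Rightarrow> nat) \<Rightarrow> 'a) set" where
  "cubes \<equiv> dyn_cubes G X act"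

lemma act_closed [simp]: "\<lbrakk>g \<in> carrier G; x \<in> topspace X\<rbrakk> \<Longrightarrow> act g x \<in> topspace X"
  using element_image by blast

lemma act_one [simp]: "x \<in> topspace X \<Longrightarrow> act \<one> x = x"
  using id_eq_one by (metis restrict_apply')

lemma act_PiE: "g \<in> carrier G \<Longrightarrow> act g \<in> topspace X \<rightarrow>\<^sub>E topspace X"
  using bij_prop0[of g] by (auto simp: Bij_def PiE_iff)

definition base_cube :: "nat \<Rightarrow> ((nat \<Rightarrow> nat) \<Rightarrow> 'g) \<Rightarrow> 'a \<Rightarrow> (nat \<Rightarrow> nat) \<Rightarrow> 'a" where
  "base_cube n g x = (\<lambda>\<omega>\<in>dcube n. act (g \<omega>) x)"

lemma dyn_cubes_base: "cubes n = cube_power X n closure_of {base_cube n g x | g x. g \<in> host_kra G n \<and> x \<in> topspace X}"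
  by (simp add: dyn_cubes_def base_cube_def)

lemma closedin_cubes: "closedin (cube_power X n) (cubes n)"
  by (simp add: dyn_cubes_def)

lemma cubes_carrier: "c \<in> cubes n \<Longrightarrow> c \<in> dcube n \<rightarrow>\<^sub>E topspace X"
  using closedin_subset[OF closedin_cubes] by (auto simp: topspace_cube_power)

lemma cubes_closed [simp]: "\<lbrakk>c \<in> cubes n; \<omega> \<in> dcube n\<rbrakk> \<Longrightarrow> c \<omega> \<in> topspace X"
  using cubes_carrier by (auto simp: PiE_iff)

lemma base_cube_carrier:
  "\<lbrakk>g \<in> host_kra G n; x \<in> topspace X\<rbrakk> \<Longrightarrow> base_cube n g x \<in> dcube n \<rightarrow>\<^sub>E topspace X"
  by (auto simp: base_cube_def)

lemma base_cube_cubes: "\<lbrakk>g \<in> host_kra G n; x \<in> topspace X\<rbrakk> \<Longrightarrow> base_cube n g x \<in> cubes n"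
proof -
  assume gx: "g \<in> host_kra G n" "x \<in> topspace X"
  have "{base_cube n g x | g x. g \<in> host_kra G n \<and> x \<in> topspace X} \<subseteq> topspace (cube_power X n)"
    unfolding topspace_cube_power using base_cube_carrier by blast
  from subsetD[OF closure_of_subset[OF this]] show ?thesis
    using gx by (auto simp: dyn_cubes_base)
qed

lemma cubes_subset_closed:
  assumes "closedin (cube_power X n) S"
    and "\<And>g x. \<lbrakk>g \<in> host_kra G n; x \<in> topspace X\<rbrakk> \<Longrightarrow> base_cube n g x \<in> S"
  shows "cubes n \<subseteq> S"
  unfolding dyn_cubes_base using assms(2) by (intro closure_of_minimal[OF _ assms(1)]) auto

text \<open>Density principle: a closed condition depending continuously on the cube has to be
  checked at base cubes only.\<close>

lemma cubes_continuous_image: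
  assumes f: "continuous_map (cube_power X n) Z f" and S: "closedin Z S"
    and gen: "\<And>g x. \<lbrakk>g \<in> host_kra G n; x \<in> topspace X\<rbrakk> \<Longrightarrow> f (base_cube n g x) \<in> S"
    and c: "c \<in> cubes n"
  shows "f c \<in> S"
proof -
  have "cubes n \<subseteq> {c \<in> topspace (cube_power X n). f c \<in> S}"
    using closedin_continuous_map_preimage[OF f S] gen base_cube_carrier
    by (intro cubes_subset_closed) (simp_all add: topspace_cube_power)
  then show ?thesis using c by blast
qed

lemma host_kra_cubes:
  assumes "a \<in> host_kra G n" "c \<in> cubes n"
  shows "(\<lambda>\<omega>\<in>dcube n. act (a \<omega>) (c \<omega>)) \<in> cubes n"
proof (rule cubes_continuous_image[OF _ closedin_cubes _ assms(2)])
  show "continuous_map (cube_power X n) (cube_power X n) (\<lambda>c. \<lambda>\<omega>\<in>dcube n. act (a \<omega>) (c \<omega>))"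
    using assms(1) by (intro continuous_map_cube_power continuous_map_compose[OF continuous_map_cube_power_projection, unfolded o_def])
      (auto intro: continuous_act)
  show "(\<lambda>\<omega>\<in>dcube n. act (a \<omega>) (base_cube n g x \<omega>)) \<in> cubes n"
    if "g \<in> host_kra G n" "x \<in> topspace X" for g x
  proof -
    have "(\<lambda>\<omega>\<in>dcube n. act (a \<omega>) (base_cube n g x \<omega>)) = base_cube n (\<lambda>\<omega>\<in>dcube n. a \<omega> \<otimes> g \<omega>) x"
      using that assms(1) by (auto simp: base_cube_def composition_rule)
    then show ?thesis
      using that assms(1) by (simp add: base_cube_cubes host_kra_mult)
  qed
qed

lemma const_cubes: "x \<in> topspace X \<Longrightarrow> (\<lambda>\<omega>\<in>dcube n. x) \<in> cubes n"
  using base_cube_cubes[OF host_kra_one, of x n] by (simp add: base_cube_def cong: restrict_cong)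

lemma compose_cubes:
  assumes f: "cube_morphism n k f" and c: "c \<in> cubes k"
  shows "compose (dcube n) c f \<in> cubes n"
proof -
  have fd: "f \<omega> \<in> dcube k" if "\<omega> \<in> dcube n" for \<omega>
    using f that by (auto simp: cube_morphism_def)
  show ?thesis
  proof (cases "n = 0")
    case True
    then have "compose (dcube n) c f = (\<lambda>\<omega>\<in>dcube n. c (f (\<lambda>_. undefined)))"
      by (auto simp: compose_def dcube_0)
    moreover have "c (f (\<lambda>_. undefined)) \<in> topspace X"
      using True by (intro cubes_closed[OF c] fd) (simp add: dcube_0)
    ultimately show ?thesis
      by (simp only: const_cubes)
  next
    case False
    show ?thesis unfolding compose_def
    proof (rule cubes_continuous_image[OF _ closedin_cubes _ c])
      show "continuous_map (cube_power X k) (cube_power X n) (\<lambda>c. \<lambda>\<omega>\<in>dcube n. c (f \<omega>))"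
        using fd by (intro continuous_map_cube_power continuous_map_cube_power_projection)
      show "(\<lambda>\<omega>\<in>dcube n. base_cube k g x (f \<omega>)) \<in> cubes n"
        if "g \<in> host_kra G k" "x \<in> topspace X" for g x
      proof -
        have "(\<lambda>\<omega>\<in>dcube n. base_cube k g x (f \<omega>)) = base_cube n (compose (dcube n) g f) x"
          using fd by (auto simp: base_cube_def compose_def)
        then show ?thesis
          using that False f by (simp add: base_cube_cubes host_kra_compose)
      qed
    qed
  qed
qed

lemma cubespace_cubes: "cubespace X cubes"
  by (auto simp: cubespace_def compact Hausdorff closedin_cubes intro: compose_cubes)

end

text \<open>The image of the compact set of cubes is closed, and it contains the base cubes of Y
  because base points lift; the other inclusion is the density principle. It serves the maps from M
  to X, from X to its quotient, and from X to an arbitrary factor.\<close>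

lemma cubes_factor_image:
  assumes "flow G X act" "flow G Y actY" and \<phi>: "continuous_map X Y \<phi>" and surj: "\<phi> ` topspace X = topspace Y"
    and equi: "\<And>g x. \<lbrakk>g \<in> carrier G; x \<in> topspace X\<rbrakk> \<Longrightarrow> \<phi> (act g x) = actY g (\<phi> x)"
  shows "dyn_cubes G Y actY n = (\<lambda>c. \<lambda>\<omega>\<in>dcube n. \<phi> (c \<omega>)) ` dyn_cubes G X act n"
proof -
  interpret X: flow G X act by fact
  interpret Y: flow G Y actY by fact
  let ?f = "\<lambda>c. \<lambda>\<omega>\<in>dcube n. \<phi> (c \<omega>)"
  have cont: "continuous_map (cube_power X n) (cube_power Y n) ?f"
    by (intro continuous_map_cube_power continuous_map_compose[OF continuous_map_cube_power_projection \<phi>, unfolded o_def])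
  have eq: "?f (X.base_cube n g x) = Y.base_cube n g (\<phi> x)" if "g \<in> host_kra G n" "x \<in> topspace X" for g x
    using that equi by (auto simp: X.base_cube_def Y.base_cube_def)
  show ?thesis
  proof
    have "closedin (cube_power Y n) (?f ` X.cubes n)"
      by (intro compactin_imp_closedin[OF Hausdorff_space_cube_power[OF Y.Hausdorff]] image_compactin[OF _ cont]
          closedin_compact_space[OF compact_space_cube_power[OF X.compact] X.closedin_cubes])
    then show "Y.cubes n \<subseteq> ?f ` X.cubes n"
    proof (rule Y.cubes_subset_closed)
      show "Y.base_cube n g y \<in> ?f ` X.cubes n" if g: "g \<in> host_kra G n" and "y \<in> topspace Y" for g y
      proof -
        obtain x where x: "x \<in> topspace X" "y = \<phi> x"
          using \<open>y \<in> topspace Y\<close> surj by blast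
        show ?thesis
          unfolding x(2) eq[OF g x(1), symmetric] by (intro imageI X.base_cube_cubes g x(1))
      qed
    qed
    have im: "\<phi> x \<in> topspace Y" if "x \<in> topspace X" for x
      using that surj by blast
    have "?f c \<in> Y.cubes n" if c: "c \<in> X.cubes n" for c
    proof (rule X.cubes_continuous_image[OF cont Y.closedin_cubes _ c])
      show "?f (X.base_cube n g x) \<in> Y.cubes n" if "g \<in> host_kra G n" "x \<in> topspace X" for g x
        unfolding eq[OF that] by (intro Y.base_cube_cubes that im)
    qed
    then show "?f ` X.cubes n \<subseteq> Y.cubes n" by blast
  qed
qed

section \<open>The enveloping semigroup\<close>

lemma group_actionI:
  assumes "group G"
    and ext: "\<And>g. g \<in> carrier G \<Longrightarrow> act g \<in> extensional E"
    and closed: "\<And>g x. \<lbrakk>g \<in> carrier G; x \<in> E\<rbrakk> \<Longrightarrow> act g x \<in> E"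
    and one: "\<And>x. x \<in> E \<Longrightarrow> act \<one>\<^bsub>G\<^esub> x = x"
    and mult: "\<And>g h x. \<lbrakk>g \<in> carrier G; h \<in> carrier G; x \<in> E\<rbrakk> \<Longrightarrow> act (g \<otimes>\<^bsub>G\<^esub> h) x = act g (act h x)"
  shows "group_action G E act"
proof -
  interpret group G by fact
  have inv: "act (inv\<^bsub>G\<^esub> g) (act g x) = x" "act g (act (inv\<^bsub>G\<^esub> g) x) = x" if "g \<in> carrier G" "x \<in> E" for g x
    using that mult[of "inv\<^bsub>G\<^esub> g" g x] mult[of g "inv\<^bsub>G\<^esub> g" x] one by simp_all
  have Bij: "act g \<in> Bij E" if "g \<in> carrier G" for g
    using that ext closed inv
    by (auto simp: Bij_def intro!: bij_betwI[where g = "act (inv\<^bsub>G\<^esub> g)"])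
  have "act (g \<otimes>\<^bsub>G\<^esub> h) = compose E (act g) (act h)" if "g \<in> carrier G" "h \<in> carrier G" for g h
    using that mult ext[of "g \<otimes>\<^bsub>G\<^esub> h"] by (intro extensionalityI[of _ E]) (auto simp: compose_def)
  then have "act \<in> hom G (BijGroup E)"
    using Bij by (auto simp: hom_def BijGroup_def)
  then show ?thesis
    using \<open>group G\<close> group_BijGroup by (auto simp: group_action_def group_hom_def group_hom_axioms_def)
qed

section \<open>Pointwise limits of the action maps and their effect on cubes\<close>

context flow
begin

definition etop :: "('a \<Rightarrow> 'a) topology" where
  "etop = product_topology (\<lambda>_. X) (topspace X)"

definition env :: "('a \<Rightarrow> 'a) set" where
  "env = etop closure_of (act ` carrier G)"

abbreviation comp :: "('a \<Rightarrow> 'a) \<Rightarrow> ('a \<Rightarrow> 'a) \<Rightarrow> 'a \<Rightarrow> 'a" (infixl \<open>\<star>\<close> 70) where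
  "p \<star> q \<equiv> compose (topspace X) p q"

lemma topspace_etop: "topspace etop = topspace X \<rightarrow>\<^sub>E topspace X"
  by (simp add: etop_def)

lemma compact_space_etop: "compact_space etop"
  by (simp add: etop_def compact_space_product_topology compact)

lemma Hausdorff_space_etop: "Hausdorff_space etop"
  by (simp add: etop_def Hausdorff_space_product_topology Hausdorff)

lemma closedin_env: "closedin etop env"
  by (simp add: env_def)

lemma env_carrier: "p \<in> env \<Longrightarrow> p \<in> topspace X \<rightarrow>\<^sub>E topspace X"
  using closedin_subset[OF closedin_env] by (auto simp: topspace_etop)

lemma env_closed [simp]: "\<lbrakk>p \<in> env; x \<in> topspace X\<rbrakk> \<Longrightarrow> p x \<in> topspace X"
  using env_carrier by (auto simp: PiE_iff)

lemma act_env: "g \<in> carrier G \<Longrightarrow> act g \<in> env"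
  using closure_of_subset[of "act ` carrier G" etop] act_PiE
  by (auto simp: env_def topspace_etop)

text \<open>The density principle for \<open>env\<close>. Continuity is asked on the subspace
  \<open>env\<close> because in \<open>MF_env\<close> the map takes values in M only for p in
  \<open>env\<close>.\<close>

lemma env_continuous_image:
  assumes f: "continuous_map (subtopology etop env) Z f" and S: "closedin Z S"
    and gen: "\<And>g. g \<in> carrier G \<Longrightarrow> f (act g) \<in> S" and p: "p \<in> env"
  shows "f p \<in> S"
proof -
  have sub: "topspace (subtopology etop env) = env"
    using closedin_subset[OF closedin_env] by (simp add: inf_absorb2)
  have "closedin etop {q \<in> env. f q \<in> S}"
    using closedin_continuous_map_preimage[OF f S]
    unfolding sub closedin_closed_subtopology[OF closedin_env] by blast
  then have "env \<subseteq> {q \<in> env. f q \<in> S}"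
    using gen act_env by (subst env_def, intro closure_of_minimal) auto
  then show ?thesis using p by blast
qed

lemma continuous_map_eval:
  "x \<in> topspace X \<Longrightarrow> continuous_map etop X (\<lambda>p. p x)"
  unfolding etop_def by (rule continuous_map_product_projection)

text \<open>Right translations are continuous for every q, while left translations are treated only
  for group elements; this asymmetry dictates the order of limits in
  \<open>env_comp\<close>.\<close>

lemma continuous_map_comp_right:
  assumes "q \<in> topspace X \<rightarrow>\<^sub>E topspace X"
  shows "continuous_map etop etop (\<lambda>p. p \<star> q)"
  unfolding etop_def compose_def using assms
  by (auto simp: continuous_map_componentwise intro!: continuous_map_product_projection)

lemma continuous_map_comp_left:
  assumes "g \<in> carrier G"
  shows "continuous_map etop etop (\<lambda>q. act g \<star> q)"
  unfolding etop_def compose_def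
  by (auto simp: continuous_map_componentwise intro!: continuous_map_compose[OF _ continuous_act[OF assms], unfolded o_def] continuous_map_product_projection)

lemma comp_assoc: "r \<in> topspace X \<rightarrow>\<^sub>E topspace X \<Longrightarrow> p \<star> q \<star> r = p \<star> (q \<star> r)"
  by (auto simp: compose_def PiE_iff)

lemma act_comp_act: "\<lbrakk>g \<in> carrier G; h \<in> carrier G\<rbrakk> \<Longrightarrow> act g \<star> act h = act (g \<otimes> h)"
  using act_PiE[of "g \<otimes> h"] by (auto simp: compose_def composition_rule PiE_iff extensional_def fun_eq_iff)

lemma env_comp:
  assumes "p \<in> env" "q \<in> env"
  shows "p \<star> q \<in> env"
proof (rule env_continuous_image[OF _ closedin_env _ assms(1)])
  show "continuous_map (subtopology etop env) etop (\<lambda>p. p \<star> q)"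
    using assms env_carrier by (intro continuous_map_from_subtopology continuous_map_comp_right)
  \<comment> \<open>With the left factor reduced to a homeomorphism, the limit in the right factor
    can be taken.\<close>
  show "act g \<star> q \<in> env" if g: "g \<in> carrier G" for g
  proof (rule env_continuous_image[OF _ closedin_env _ assms(2)])
    show "continuous_map (subtopology etop env) etop (\<lambda>q. act g \<star> q)"
      using g by (intro continuous_map_from_subtopology continuous_map_comp_left)
    show "act g \<star> act h \<in> env" if "h \<in> carrier G" for h
      using g that by (simp add: act_comp_act act_env)
  qed
qed

text \<open>The limit is taken in p with the cube c held fixed, so discontinuity of p does no harm;
  for p in the group this is invariance under a face element.\<close>

lemma cubes_env_face:
  assumes p: "p \<in> env" and F: "F \<in> hyperfaces n" and c: "c \<in> cubes n"
  shows "(\<lambda>\<omega>\<in>dcube n. if \<omega> \<in> F then p (c \<omega>) else c \<omega>) \<in> cubes n"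
proof (rule env_continuous_image[OF _ closedin_cubes _ p])
  show "continuous_map (subtopology etop env) (cube_power X n) (\<lambda>p. \<lambda>\<omega>\<in>dcube n. if \<omega> \<in> F then p (c \<omega>) else c \<omega>)"
  proof (intro continuous_map_cube_power continuous_map_from_subtopology)
    show "continuous_map etop X (\<lambda>p. if \<omega> \<in> F then p (c \<omega>) else c \<omega>)" if "\<omega> \<in> dcube n" for \<omega>
      using continuous_map_eval[of "c \<omega>"] that c by (cases "\<omega> \<in> F") auto
  qed
  show "(\<lambda>\<omega>\<in>dcube n. if \<omega> \<in> F then act g (c \<omega>) else c \<omega>) \<in> cubes n" if "g \<in> carrier G" for g
  proof -
    have "(\<lambda>\<omega>\<in>dcube n. if \<omega> \<in> F then act g (c \<omega>) else c \<omega>) =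
        (\<lambda>\<omega>\<in>dcube n. act (face_element G n g F \<omega>) (c \<omega>))"
      using c by (auto simp: face_element_def)
    then show ?thesis
      using host_kra_cubes[OF host_kra_face[OF that F] c] by simp
  qed
qed

text \<open>Apply p on one hyperface and then on the opposite one; each vertex is hit exactly
  once.\<close>

lemma cubes_env:
  assumes p: "p \<in> env" and c: "c \<in> cubes n" and "n \<ge> 1"
  shows "(\<lambda>\<omega>\<in>dcube n. p (c \<omega>)) \<in> cubes n"
proof -
  let ?F = "\<lambda>a. {\<omega> \<in> dcube n. \<omega> 1 = a}"
  have F: "?F 0 \<in> hyperfaces n" "?F 1 \<in> hyperfaces n"
    using \<open>n \<ge> 1\<close> by (auto intro!: hyperface_mem)
  have "(\<lambda>\<omega>\<in>dcube n. p (c \<omega>)) =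
      (\<lambda>\<omega>\<in>dcube n. if \<omega> \<in> ?F 1 then p ((\<lambda>\<omega>\<in>dcube n. if \<omega> \<in> ?F 0 then p (c \<omega>) else c \<omega>) \<omega>)
         else (\<lambda>\<omega>\<in>dcube n. if \<omega> \<in> ?F 0 then p (c \<omega>) else c \<omega>) \<omega>)"
  proof (rule restrict_ext)
    fix \<omega> assume "\<omega> \<in> dcube n"
    then have "\<omega> 1 = 0 \<or> \<omega> 1 = 1"
      using \<open>n \<ge> 1\<close> by (intro dcube_cases) auto
    then show "p (c \<omega>) = (if \<omega> \<in> ?F 1 then p ((\<lambda>\<omega>\<in>dcube n. if \<omega> \<in> ?F 0 then p (c \<omega>) else c \<omega>) \<omega>)
         else (\<lambda>\<omega>\<in>dcube n. if \<omega> \<in> ?F 0 then p (c \<omega>) else c \<omega>) \<omega>)"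
      using \<open>\<omega> \<in> dcube n\<close> by auto
  qed
  also have "\<dots> \<in> cubes n"
    by (rule cubes_env_face[OF p F(2) cubes_env_face[OF p F(1) c]])
  finally show ?thesis .
qed

text \<open>The vertices other than the top one are the union of the hyperfaces \<open>\<omega> i = 0\<close>; idempotency
  makes the application of \<open>p\<close> on overlapping hyperfaces harmless.\<close>

lemma cubes_env_off_top:
  assumes p: "p \<in> env" and idem: "\<And>x. x \<in> topspace X \<Longrightarrow> p (p x) = p x" and c: "c \<in> cubes n"
  shows "(\<lambda>\<omega>\<in>dcube n. if \<omega> = top_vertex n then c \<omega> else p (c \<omega>)) \<in> cubes n"
proof -
  have step: "(\<lambda>\<omega>\<in>dcube n. if \<exists>i\<in>{1..m}. \<omega> i = 0 then p (c \<omega>) else c \<omega>) \<in> cubes n" (is "?c m \<in> _")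
    if "m \<le> n" for m
    using that
  proof (induction m)
    case 0
    have "(\<lambda>\<omega>\<in>dcube n. c \<omega>) = c"
      using PiE_restrict[OF cubes_carrier[OF c]] .
    then show ?case using c by simp
  next
    case (Suc m)
    let ?F = "{\<omega> \<in> dcube n. \<omega> (Suc m) = 0}"
    have F: "?F \<in> hyperfaces n"
      using Suc.prems by (intro hyperface_mem) auto
    have "?c (Suc m) = (\<lambda>\<omega>\<in>dcube n. if \<omega> \<in> ?F then p (?c m \<omega>) else ?c m \<omega>)"
    proof (rule restrict_ext)
      fix \<omega> assume \<omega>: "\<omega> \<in> dcube n"
      have "(\<exists>i\<in>{1..Suc m}. \<omega> i = 0) \<longleftrightarrow> \<omega> (Suc m) = 0 \<or> (\<exists>i\<in>{1..m}. \<omega> i = 0)"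
        by (auto simp: atLeastAtMostSuc_conv)
      then show "(if \<exists>i\<in>{1..Suc m}. \<omega> i = 0 then p (c \<omega>) else c \<omega>) =
          (if \<omega> \<in> ?F then p (?c m \<omega>) else ?c m \<omega>)"
        using \<omega> c idem[of "c \<omega>"] by simp
    qed
    then show ?case
      using cubes_env_face[OF p F] Suc by simp
  qed
  have eq: "(\<lambda>\<omega>\<in>dcube n. if \<exists>i\<in>{1..n}. \<omega> i = 0 then p (c \<omega>) else c \<omega>) =
      (\<lambda>\<omega>\<in>dcube n. if \<omega> = top_vertex n then c \<omega> else p (c \<omega>))"
  proof (rule restrict_ext)
    fix \<omega> assume "\<omega> \<in> dcube n"
    from dcube_neq_top_vertex_iff[OF this]
    show "(if \<exists>i\<in>{1..n}. \<omega> i = 0 then p (c \<omega>) else c \<omega>) = (if \<omega> = top_vertex n then c \<omega> else p (c \<omega>))"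
      by (cases "\<omega> = top_vertex n") (simp_all only: not_True_eq_False not_False_eq_True simp_thms if_True if_False)
  qed
  show ?thesis
    using step[OF order_refl] unfolding eq .
qed

section \<open>Minimal closed left ideals\<close>

definition left_ideal :: "('a \<Rightarrow> 'a) set \<Rightarrow> bool" where
  "left_ideal S \<longleftrightarrow> closedin etop S \<and> S \<noteq> {} \<and> S \<subseteq> env \<and> (\<forall>p\<in>env. \<forall>q\<in>S. p \<star> q \<in> S)"

lemma minimal_left_ideal_exists:
  obtains M where "left_ideal M" "\<And>S. \<lbrakk>left_ideal S; S \<subseteq> M\<rbrakk> \<Longrightarrow> S = M"
proof -
  have "left_ideal env"
    using closedin_env env_comp act_env[OF one_closed] by (auto simp: left_ideal_def)
  have Inter: "left_ideal (\<Inter>\<C>)" if "\<C> \<noteq> {}" "\<C> \<subseteq> Collect left_ideal" "\<Inter>\<C> \<noteq> {}" for \<C>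
  proof -
    have \<C>: "closedin etop S" "S \<subseteq> env" "\<And>p q. \<lbrakk>p \<in> env; q \<in> S\<rbrakk> \<Longrightarrow> p \<star> q \<in> S" if "S \<in> \<C>" for S
      using subsetD[OF \<open>\<C> \<subseteq> Collect left_ideal\<close> that] by (simp_all add: left_ideal_def)
    have "closedin etop (\<Inter>\<C>)"
      using \<C>(1) by (rule closedin_Inter[OF \<open>\<C> \<noteq> {}\<close>])
    moreover have "\<Inter>\<C> \<subseteq> env"
      using \<C>(2) \<open>\<C> \<noteq> {}\<close> by (rule Inter_subset)
    moreover have "p \<star> q \<in> \<Inter>\<C>" if "p \<in> env" "q \<in> \<Inter>\<C>" for p q
      using that \<C>(3) by (intro InterI) auto
    ultimately show ?thesis
      using \<open>\<Inter>\<C> \<noteq> {}\<close> by (simp add: left_ideal_def)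
  qed
  obtain M where M: "M \<in> Collect left_ideal" "\<And>S. \<lbrakk>S \<in> Collect left_ideal; S \<subseteq> M\<rbrakk> \<Longrightarrow> S = M"
  proof (rule minimal_closed_set[OF compact_space_etop, of "Collect left_ideal"])
    show "Collect left_ideal \<noteq> {}"
      using \<open>left_ideal env\<close> by auto
    show "closedin etop S \<and> S \<noteq> {}" if "S \<in> Collect left_ideal" for S
      using that by (simp add: left_ideal_def)
  qed (use Inter in auto)
  have "left_ideal M"
    using M(1) by simp
  moreover have "S = M" if "left_ideal S" "S \<subseteq> M" for S
    using M(2)[of S] that by simp
  ultimately show thesis by (rule that)
qed

end

section \<open>Minimal left ideals as flows\<close>

locale ideal_flow = flow G X act
  for G :: "('g, 'm) monoid_scheme" (structure) and X :: "'a topology" and act :: "'g \<Rightarrow> 'a \<Rightarrow> 'a" +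
  fixes M :: "('a \<Rightarrow> 'a) set" and u :: "'a \<Rightarrow> 'a"
  assumes left_ideal_M: "left_ideal M"
    and minimal_M: "\<lbrakk>left_ideal S; S \<subseteq> M\<rbrakk> \<Longrightarrow> S = M"
    and u_M: "u \<in> M" and u_idem: "u \<star> u = u"
begin

lemma closedin_M: "closedin etop M"
  and M_env: "p \<in> M \<Longrightarrow> p \<in> env"
  and env_comp_M: "\<lbrakk>p \<in> env; q \<in> M\<rbrakk> \<Longrightarrow> p \<star> q \<in> M"
  using left_ideal_M by (auto simp: left_ideal_def)

lemma M_carrier: "p \<in> M \<Longrightarrow> p \<in> topspace X \<rightarrow>\<^sub>E topspace X"
  by (simp add: M_env env_carrier)

lemma M_comp_M: "\<lbrakk>p \<in> M; q \<in> M\<rbrakk> \<Longrightarrow> p \<star> q \<in> M"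
  by (simp add: M_env env_comp_M)

lemma M_assoc: "r \<in> M \<Longrightarrow> p \<star> q \<star> r = p \<star> (q \<star> r)"
  by (simp add: M_carrier comp_assoc)

text \<open>The set \<open>M \<star> q\<close> is a closed left ideal inside M, so minimality forces
  equality. Hence \<open>p \<star> q = m\<close> can be solved for p in M.\<close>

lemma comp_image_M:
  assumes q: "q \<in> M"
  shows "(\<lambda>p. p \<star> q) ` M = M"
proof (rule minimal_M)
  show sub: "(\<lambda>p. p \<star> q) ` M \<subseteq> M"
    using q M_comp_M by auto
  have "closedin etop ((\<lambda>p. p \<star> q) ` M)"
    by (intro compactin_imp_closedin[OF Hausdorff_space_etop]
        image_compactin[OF _ continuous_map_comp_right[OF M_carrier[OF q]]]
        closedin_compact_space[OF compact_space_etop closedin_M])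
  moreover have "r \<star> (p \<star> q) \<in> (\<lambda>p. p \<star> q) ` M" if "r \<in> env" "p \<in> M" for r p
    using that q env_comp_M by (intro image_eqI[of _ _ "r \<star> p"]) (simp_all add: M_assoc)
  ultimately show "left_ideal ((\<lambda>p. p \<star> q) ` M)"
    using sub q M_env by (auto simp: left_ideal_def)
qed

lemma M_divide:
  assumes "q \<in> M" "m \<in> M"
  obtains p where "p \<in> M" "m = p \<star> q"
proof -
  have "m \<in> (\<lambda>p. p \<star> q) ` M"
    using assms by (simp only: comp_image_M)
  then show thesis using that by auto
qed

text \<open>Write m as \<open>p \<star> v\<close> and absorb v. Any two idempotents v, w of M thus
  satisfy \<open>v \<star> w = v\<close>.\<close>

lemma idem_right_identity:
  assumes "v \<in> M" "v \<star> v = v" "m \<in> M"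
  shows "m \<star> v = m"
proof -
  obtain p where "p \<in> M" "m = p \<star> v"
    using M_divide[OF assms(1,3)] .
  then show ?thesis
    using assms by (simp add: M_assoc)
qed

section \<open>The group u M\<close>

definition GG :: "('a \<Rightarrow> 'a) monoid" where
  "GG = \<lparr>carrier = {m \<in> M. u \<star> m = m}, monoid.mult = (\<lambda>p q. p \<star> q), one = u\<rparr>"

lemma carrier_GG: "carrier GG = {m \<in> M. u \<star> m = m}"
  and mult_GG [simp]: "p \<otimes>\<^bsub>GG\<^esub> q = p \<star> q"
  and one_GG [simp]: "\<one>\<^bsub>GG\<^esub> = u"
  by (simp_all add: GG_def)

lemma u_comp_GG: "m \<in> M \<Longrightarrow> u \<star> m \<in> carrier GG"
  using u_M u_idem M_comp_M M_assoc[of m u u] by (simp add: carrier_GG)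

text \<open>For inverses, solve \<open>p \<star> x = u\<close> in M; then \<open>u \<star> p\<close>
  is still a left inverse of x and lies in u M.\<close>

lemma group_GG: "group GG"
proof (rule groupI)
  show "\<one>\<^bsub>GG\<^esub> \<in> carrier GG"
    using u_M u_idem by (simp add: carrier_GG)
  show "x \<otimes>\<^bsub>GG\<^esub> y \<in> carrier GG" if "x \<in> carrier GG" "y \<in> carrier GG" for x y
    using that M_comp_M M_assoc[of y u x] by (simp add: carrier_GG)
  show "x \<otimes>\<^bsub>GG\<^esub> y \<otimes>\<^bsub>GG\<^esub> z = x \<otimes>\<^bsub>GG\<^esub> (y \<otimes>\<^bsub>GG\<^esub> z)"
    if "x \<in> carrier GG" "y \<in> carrier GG" "z \<in> carrier GG" for x y z
    using that M_assoc by (simp add: carrier_GG)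
  show "\<one>\<^bsub>GG\<^esub> \<otimes>\<^bsub>GG\<^esub> x = x" if "x \<in> carrier GG" for x
    using that by (simp add: carrier_GG)
  show "\<exists>y\<in>carrier GG. y \<otimes>\<^bsub>GG\<^esub> x = \<one>\<^bsub>GG\<^esub>" if x: "x \<in> carrier GG" for x
  proof -
    have xM: "x \<in> M" using x by (simp add: carrier_GG)
    obtain p where p: "p \<in> M" "u = p \<star> x"
      using M_divide[OF xM u_M] .
    have "u \<star> p \<star> x = u \<star> (p \<star> x)"
      by (rule M_assoc[OF xM])
    also have "\<dots> = u"
      using u_idem by (simp flip: p(2))
    finally show ?thesis
      using u_comp_GG[OF p(1)] by auto
  qed
qed

sublocale GG: group GG
  by (rule group_GG)

section \<open>M as a flow, and the semigroup of its cubes\<close>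

definition Mtop :: "('a \<Rightarrow> 'a) topology" where
  "Mtop = subtopology etop M"

definition Mact :: "'g \<Rightarrow> ('a \<Rightarrow> 'a) \<Rightarrow> 'a \<Rightarrow> 'a" where
  "Mact g = (\<lambda>q\<in>M. act g \<star> q)"

lemma topspace_Mtop: "topspace Mtop = M"
  using closedin_subset[OF closedin_M] by (simp add: Mtop_def inf_absorb2)

lemma continuous_map_M_comp_right:
  assumes q: "q \<in> M"
  shows "continuous_map Mtop Mtop (\<lambda>p. p \<star> q)"
  unfolding Mtop_def continuous_map_in_subtopology
  using continuous_map_comp_right[OF M_carrier[OF q]] M_comp_M q
  by (auto intro: continuous_map_from_subtopology)

sublocale MF: flow G Mtop Mact
proof (rule flow.intro)
  show "group_action G (topspace Mtop) Mact"
  proof (rule group_actionI)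
    show "group G" by (rule is_group)
    fix g x assume g: "g \<in> carrier G" and x: "x \<in> topspace Mtop"
    show "Mact g x \<in> topspace Mtop"
      using g x env_comp_M act_env by (simp add: topspace_Mtop Mact_def)
    fix h assume h: "h \<in> carrier G"
    have "act (g \<otimes> h) \<star> x = act g \<star> (act h \<star> x)"
      using g h x by (simp add: topspace_Mtop M_assoc flip: act_comp_act)
    then show "Mact (g \<otimes> h) x = Mact g (Mact h x)"
      using g h x env_comp_M act_env by (simp add: topspace_Mtop Mact_def)
  next
    fix x assume x: "x \<in> topspace Mtop"
    then have "act \<one> \<star> x = x"
      using M_carrier[of x] by (auto simp: topspace_Mtop compose_def PiE_iff extensional_def fun_eq_iff)
    then show "Mact \<one> x = x"
      using x by (simp add: topspace_Mtop Mact_def)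
  qed (simp add: Mact_def topspace_Mtop)
  show "flow_axioms G Mtop Mact"
  proof
    show "compact_space Mtop"
      unfolding Mtop_def using closedin_compact_space[OF compact_space_etop closedin_M]
      by (simp add: compact_space_subtopology)
    show "Hausdorff_space Mtop"
      unfolding Mtop_def by (simp add: Hausdorff_space_subtopology Hausdorff_space_etop)
    show "continuous_map Mtop Mtop (Mact g)" if g: "g \<in> carrier G" for g
    proof (rule continuous_map_eq)
      show "continuous_map Mtop Mtop (\<lambda>q. act g \<star> q)"
        unfolding Mtop_def continuous_map_in_subtopology
        using continuous_map_comp_left[OF g] env_comp_M[OF act_env[OF g]]
        by (auto intro: continuous_map_from_subtopology)
    qed (simp add: Mact_def topspace_Mtop)
  qed
qed

text \<open>Makes \<open>cubes_env\<close> applicable to the flow M, with p acting by left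
  translation.\<close>

lemma MF_env:
  assumes "p \<in> env"
  shows "(\<lambda>q\<in>M. p \<star> q) \<in> MF.env"
proof (rule env_continuous_image[OF _ MF.closedin_env _ assms])
  have "continuous_map (subtopology etop env) Mtop (\<lambda>p. p \<star> q)" if q: "q \<in> M" for q
    unfolding Mtop_def continuous_map_in_subtopology
    using continuous_map_comp_right[OF M_carrier[OF q]] env_comp_M q
    by (auto intro: continuous_map_from_subtopology)
  then show "continuous_map (subtopology etop env) MF.etop (\<lambda>p. \<lambda>q\<in>M. p \<star> q)"
    by (auto simp: MF.etop_def topspace_Mtop continuous_map_componentwise)
  show "(\<lambda>q\<in>M. act g \<star> q) \<in> MF.env" if "g \<in> carrier G" for g
    using MF.act_env[OF that] by (simp add: Mact_def)
qed

lemma MF_cubes_M: "\<lbrakk>c \<in> MF.cubes n; \<omega> \<in> dcube n\<rbrakk> \<Longrightarrow> c \<omega> \<in> M"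
  using MF.cubes_closed by (simp add: topspace_Mtop)

lemma MF_cubes_comp_left:
  assumes p: "p \<in> env" and c: "c \<in> MF.cubes n" and "n \<ge> 1"
  shows "(\<lambda>\<omega>\<in>dcube n. p \<star> c \<omega>) \<in> MF.cubes n"
proof -
  have "(\<lambda>\<omega>\<in>dcube n. p \<star> c \<omega>) = (\<lambda>\<omega>\<in>dcube n. (\<lambda>q\<in>M. p \<star> q) (c \<omega>))"
    by (intro restrict_ext) (simp add: MF_cubes_M[OF c])
  then show ?thesis
    using MF.cubes_env[OF MF_env[OF p] c \<open>n \<ge> 1\<close>] by simp
qed

text \<open>Right translation by \<open>b\<close> commutes with the Host-Kra group, so it suffices to treat constant
  cubes, which right translation by \<open>b\<close> turns into left translates of \<open>b\<close>.\<close>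

lemma MF_cubes_mult:
  assumes a: "a \<in> MF.cubes n" and b: "b \<in> MF.cubes n" and "n \<ge> 1"
  shows "(\<lambda>\<omega>\<in>dcube n. a \<omega> \<star> b \<omega>) \<in> MF.cubes n"
proof (rule MF.cubes_continuous_image[OF _ MF.closedin_cubes _ a])
  show "continuous_map (cube_power Mtop n) (cube_power Mtop n) (\<lambda>a. \<lambda>\<omega>\<in>dcube n. a \<omega> \<star> b \<omega>)"
    using MF_cubes_M[OF b]
    by (intro continuous_map_cube_power continuous_map_compose[OF continuous_map_cube_power_projection
          continuous_map_M_comp_right, unfolded o_def])
  fix g m assume g: "g \<in> host_kra G n" and m: "m \<in> topspace Mtop"
  have m': "m \<in> M" using m by (simp add: topspace_Mtop)
  have "(\<lambda>\<omega>\<in>dcube n. MF.base_cube n g m \<omega> \<star> b \<omega>) =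
      (\<lambda>\<omega>\<in>dcube n. Mact (g \<omega>) ((\<lambda>\<omega>\<in>dcube n. m \<star> b \<omega>) \<omega>))"
    using g m' MF_cubes_M[OF b]
    by (intro restrict_ext) (simp add: MF.base_cube_def Mact_def M_assoc M_comp_M)
  also have "\<dots> \<in> MF.cubes n"
    using m' M_env \<open>n \<ge> 1\<close> by (intro MF.host_kra_cubes[OF g] MF_cubes_comp_left b)
  finally show "(\<lambda>\<omega>\<in>dcube n. MF.base_cube n g m \<omega> \<star> b \<omega>) \<in> MF.cubes n" .
qed

section \<open>Cubes of M with entries in u M\<close>

definition CC :: "nat \<Rightarrow> ((nat \<Rightarrow> nat) \<Rightarrow> 'a \<Rightarrow> 'a) set" where
  "CC n = {c \<in> MF.cubes n. \<forall>\<omega>\<in>dcube n. c \<omega> \<in> carrier GG}"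

lemma CC_I: "\<lbrakk>c \<in> MF.cubes n; \<And>\<omega>. \<omega> \<in> dcube n \<Longrightarrow> c \<omega> \<in> carrier GG\<rbrakk> \<Longrightarrow> c \<in> CC n"
  and CC_cubes: "c \<in> CC n \<Longrightarrow> c \<in> MF.cubes n"
  and CC_GG: "\<lbrakk>c \<in> CC n; \<omega> \<in> dcube n\<rbrakk> \<Longrightarrow> c \<omega> \<in> carrier GG"
  by (auto simp: CC_def)

lemma u_comp_CC:
  assumes c: "c \<in> MF.cubes n" and "n \<ge> 1"
  shows "(\<lambda>\<omega>\<in>dcube n. u \<star> c \<omega>) \<in> CC n"
  using MF_cubes_comp_left[OF M_env[OF u_M] assms] u_comp_GG MF_cubes_M[OF c]
  by (intro CC_I) auto

text \<open>An idempotent of the form \<open>p a\<close> exists in the closed subsemigroup \<open>MF.cubes n \<cdot> a\<close>, and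
  then \<open>u p\<close> inverts \<open>a\<close>.\<close>

lemma CC_left_inverse:
  assumes a: "a \<in> CC n" and "n \<ge> 1"
  shows "\<exists>b\<in>CC n. \<forall>\<omega>\<in>dcube n. b \<omega> \<star> a \<omega> = u"
proof -
  define m where "m = (\<lambda>a b. \<lambda>\<omega>\<in>dcube n. (a \<omega> :: 'a \<Rightarrow> 'a) \<star> b \<omega>)"
  define S where "S = (\<lambda>p. m p a) ` MF.cubes n"
  note aC = CC_cubes[OF a]
  have m_cubes: "m p q \<in> MF.cubes n" if "p \<in> MF.cubes n" "q \<in> MF.cubes n" for p q
    unfolding m_def using that \<open>n \<ge> 1\<close> by (intro MF_cubes_mult)
  have m_assoc: "m (m p q) r = m p (m q r)" if "r \<in> MF.cubes n" for p q r
    unfolding m_def by (intro restrict_ext) (simp add: M_assoc MF_cubes_M[OF that])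
  have cont: "continuous_map (cube_power Mtop n) (cube_power Mtop n) (\<lambda>p. m p q)" if "q \<in> MF.cubes n" for q
    unfolding m_def using MF_cubes_M[OF that]
    by (intro continuous_map_cube_power continuous_map_compose[OF continuous_map_cube_power_projection
          continuous_map_M_comp_right, unfolded o_def])
  have S_cubes: "p \<in> MF.cubes n" if "p \<in> S" for p
    using that m_cubes aC by (auto simp: S_def)
  obtain v where v: "v \<in> S" "m v v = v"
  proof (rule idempotent_exists[where m = m and S = S])
    show "compact_space (cube_power Mtop n)" "Hausdorff_space (cube_power Mtop n)"
      using MF.compact MF.Hausdorff by (simp_all add: compact_space_cube_power Hausdorff_space_cube_power)
    show "closedin (cube_power Mtop n) S"
      unfolding S_def
      by (intro compactin_imp_closedin[OF Hausdorff_space_cube_power[OF MF.Hausdorff]]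
          image_compactin[OF _ cont[OF aC]]
          closedin_compact_space[OF compact_space_cube_power[OF MF.compact] MF.closedin_cubes])
    show "S \<noteq> {}"
      using aC by (auto simp: S_def)
    show "m x y \<in> S" if "x \<in> S" "y \<in> S" for x y
    proof -
      obtain q where q: "q \<in> MF.cubes n" "y = m q a"
        using \<open>y \<in> S\<close> by (auto simp: S_def)
      have "m x y = m (m x q) a"
        using aC by (simp add: q(2) m_assoc)
      then show ?thesis
        using m_cubes[OF S_cubes[OF \<open>x \<in> S\<close>] q(1)] by (simp add: S_def)
    qed
    show "m (m x y) z = m x (m y z)" if "x \<in> S" "y \<in> S" "z \<in> S" for x y z
      using S_cubes[OF \<open>z \<in> S\<close>] by (rule m_assoc)
    show "continuous_map (cube_power Mtop n) (cube_power Mtop n) (\<lambda>x. m x y)" if "y \<in> S" for y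
      using S_cubes[OF that] by (rule cont)
  qed
  obtain p where p: "p \<in> MF.cubes n" "v = m p a"
    using v(1) by (auto simp: S_def)
  have "u \<star> p \<omega> \<star> a \<omega> = u" if \<omega>: "\<omega> \<in> dcube n" for \<omega>
  proof -
    have "v \<omega> \<in> M" "v \<omega> \<star> v \<omega> = v \<omega>"
      using MF_cubes_M[OF S_cubes[OF v(1)] \<omega>] fun_cong[OF v(2), of \<omega>] \<omega> by (simp_all add: m_def)
    \<comment> \<open>Every idempotent of M is a right identity of M, so u absorbs it.\<close>
    then have "u \<star> v \<omega> = u"
      using idem_right_identity u_M by simp
    moreover have "v \<omega> = p \<omega> \<star> a \<omega>"
      using p(2) \<omega> by (simp add: m_def)
    ultimately show ?thesis
      using MF_cubes_M[OF aC \<omega>] by (simp add: M_assoc)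
  qed
  then show ?thesis
    using u_comp_CC[OF p(1) \<open>n \<ge> 1\<close>] by (intro bexI[of _ "\<lambda>\<omega>\<in>dcube n. u \<star> p \<omega>"]) auto
qed

text \<open>Inverses are the delicate axiom: a pointwise inverse is a cube because the cube from
  \<open>CC_left_inverse\<close> must coincide with it, by uniqueness of inverses in u M.\<close>

lemma cube_group_CC:
  assumes "n \<ge> 1"
  shows "cube_group GG n (CC n)"
proof (intro cube_group.intro group_GG, unfold_locales)
  show "a \<in> dcube n \<rightarrow>\<^sub>E carrier GG" if "a \<in> CC n" for a
    using MF.cubes_carrier[OF CC_cubes[OF that]] CC_GG[OF that] by (auto simp: PiE_iff)
  have "(\<lambda>\<omega>\<in>dcube n. u) \<in> CC n"
    using u_M GG.one_closed by (intro CC_I MF.const_cubes) (simp_all add: topspace_Mtop)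
  then show "(\<lambda>\<omega>\<in>dcube n. \<one>\<^bsub>GG\<^esub>) \<in> CC n"
    by simp
  show "(\<lambda>\<omega>\<in>dcube n. a \<omega> \<otimes>\<^bsub>GG\<^esub> b \<omega>) \<in> CC n" if a: "a \<in> CC n" and b: "b \<in> CC n" for a b
  proof (rule CC_I)
    show "(\<lambda>\<omega>\<in>dcube n. a \<omega> \<otimes>\<^bsub>GG\<^esub> b \<omega>) \<in> MF.cubes n"
      using MF_cubes_mult[OF CC_cubes[OF a] CC_cubes[OF b] assms] by simp
    show "(\<lambda>\<omega>\<in>dcube n. a \<omega> \<otimes>\<^bsub>GG\<^esub> b \<omega>) \<omega> \<in> carrier GG" if "\<omega> \<in> dcube n" for \<omega>
      using that CC_GG[OF a that] CC_GG[OF b that] GG.m_closed by simp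
  qed
  show "(\<lambda>\<omega>\<in>dcube n. inv\<^bsub>GG\<^esub> a \<omega>) \<in> CC n" if a: "a \<in> CC n" for a
  proof -
    obtain b where b: "b \<in> CC n" "\<And>\<omega>. \<omega> \<in> dcube n \<Longrightarrow> b \<omega> \<star> a \<omega> = u"
      using CC_left_inverse[OF a assms] by blast
    have "inv\<^bsub>GG\<^esub> a \<omega> = b \<omega>" if "\<omega> \<in> dcube n" for \<omega>
      using b(2)[OF that] CC_GG[OF a that] CC_GG[OF b(1) that] by (intro GG.inv_equality) simp_all
    then have "(\<lambda>\<omega>\<in>dcube n. inv\<^bsub>GG\<^esub> a \<omega>) = (\<lambda>\<omega>\<in>dcube n. b \<omega>)"
      by (intro restrict_ext)
    also have "\<dots> = b"
      using PiE_restrict[OF MF.cubes_carrier[OF CC_cubes[OF b(1)]]] .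
    finally show ?thesis using b(1) by simp
  qed
  show "(\<lambda>\<omega>'\<in>dcube n. a (inf \<omega>' \<omega>)) \<in> CC n" if a: "a \<in> CC n" and \<omega>: "\<omega> \<in> dcube n" for a \<omega>
  proof (rule CC_I)
    show "(\<lambda>\<omega>'\<in>dcube n. a (inf \<omega>' \<omega>)) \<in> MF.cubes n"
      using MF.compose_cubes[OF cube_morphism_inf[OF \<omega>] CC_cubes[OF a]] by (simp add: compose_def)
    show "(\<lambda>\<omega>'\<in>dcube n. a (inf \<omega>' \<omega>)) \<omega>' \<in> carrier GG" if "\<omega>' \<in> dcube n" for \<omega>'
      using that \<omega> by (simp add: CC_GG[OF a] inf_dcube)
  qed
qed

end

section \<open>The relation NRP in a minimal system\<close>

lemma lower_corner_map:
  "(\<lambda>\<omega>\<in>dcube n. f (lower_corner n x y \<omega>)) = lower_corner n (f x) (f y)"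
  by (auto simp: lower_corner_def)

lemma lower_corner_top [simp]: "lower_corner n x y (top_vertex n) = y"
  by (simp add: lower_corner_def top_vertex_dcube)

lemma lower_corner_eqI:
  assumes "c \<in> extensional (dcube n)" "\<And>\<omega>. \<lbrakk>\<omega> \<in> dcube n; \<omega> \<noteq> top_vertex n\<rbrakk> \<Longrightarrow> c \<omega> = x" "c (top_vertex n) = y"
  shows "c = lower_corner n x y"
  using assms by (intro extensionalityI[of _ "dcube n"]) (auto simp: lower_corner_def)

lemma (in flow) closedin_NRP: "closedin (prod_topology X X) (NRP G X act d)"
proof -
  have "continuous_map (prod_topology X X) (cube_power X (d + 1))
      (\<lambda>z. \<lambda>\<omega>\<in>dcube (d + 1). if \<omega> = top_vertex (d + 1) then snd z else fst z)"
  proof (rule continuous_map_cube_power)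
    show "continuous_map (prod_topology X X) X (\<lambda>z. if \<omega> = top_vertex (d + 1) then snd z else fst z)" for \<omega>
      by (cases "\<omega> = top_vertex (d + 1)") (simp_all add: continuous_map_fst continuous_map_snd)
  qed
  from closedin_continuous_map_preimage[OF this closedin_cubes]
  have "closedin (prod_topology X X)
      {z \<in> topspace X \<times> topspace X. lower_corner (d + 1) (fst z) (snd z) \<in> cubes (d + 1)}"
    by (simp only: lower_corner_def topspace_prod_topology)
  also have "{z \<in> topspace X \<times> topspace X. lower_corner (d + 1) (fst z) (snd z) \<in> cubes (d + 1)} = NRP G X act d"
    by (auto simp: NRP_def)
  finally show ?thesis .
qed

lemma (in flow) NRP_env:
  assumes "(x, y) \<in> NRP G X act d" "p \<in> env"
  shows "(p x, p y) \<in> NRP G X act d"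
  using cubes_env[OF assms(2), of "lower_corner (d + 1) x y" "d + 1"] assms
  by (auto simp: NRP_def lower_corner_map)

locale minimal_ideal_flow = ideal_flow G X act M u
  for G :: "('g, 'm) monoid_scheme" (structure) and X :: "'a topology" and act :: "'g \<Rightarrow> 'a \<Rightarrow> 'a"
    and M u +
  assumes minimal: "x \<in> topspace X \<Longrightarrow> X closure_of orbit G act x = topspace X"
begin

lemma M_closed [simp]: "\<lbrakk>p \<in> M; x \<in> topspace X\<rbrakk> \<Longrightarrow> p x \<in> topspace X"
  by (simp add: M_env)

lemma comp_apply: "\<lbrakk>p \<star> q = r; x \<in> topspace X\<rbrakk> \<Longrightarrow> p (q x) = r x"
  by (auto simp: compose_eq)

lemma M_transitive:
  assumes x: "x \<in> topspace X" and y: "y \<in> topspace X"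
  shows "\<exists>m\<in>M. m x = y"
proof -
  have "closedin X ((\<lambda>m. m x) ` M)"
    by (intro compactin_imp_closedin[OF Hausdorff] image_compactin[OF _ continuous_map_eval[OF x]]
        closedin_compact_space[OF compact_space_etop closedin_M])
  \<comment> \<open>The orbit of \<open>u x\<close>, rather than of x, is visibly inside M x, since
    each \<open>act g \<star> u\<close> is in M.\<close>
  moreover have "orbit G act (u x) \<subseteq> (\<lambda>m. m x) ` M"
    using x u_M env_comp_M[OF act_env u_M] by (auto simp: orbit_def compose_eq intro!: image_eqI[of _ _ "act _ \<star> u"])
  ultimately have "topspace X \<subseteq> (\<lambda>m. m x) ` M"
    using minimal[of "u x"] closure_of_minimal x u_M by (metis M_closed)
  then show ?thesis using y by auto
qed

text \<open>The elements of M fixing x form a closed subsemigroup, nonempty by transitivity of M on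
  X.\<close>

lemma idem_fixing:
  assumes x: "x \<in> topspace X"
  obtains v where "v \<in> M" "v \<star> v = v" "v x = x"
proof -
  define S where "S = {p \<in> M. p x = x}"
  obtain v where "v \<in> S" "v \<star> v = v"
  proof (rule idempotent_exists[OF compact_space_etop Hausdorff_space_etop, where m = "\<lambda>p q. p \<star> q" and S = S])
    have "closedin etop (M \<inter> {p \<in> topspace etop. p x \<in> {x}})"
      by (intro closedin_Int closedin_M closedin_continuous_map_preimage[OF continuous_map_eval[OF x]])
        (simp add: closedin_Hausdorff_sing_eq[OF Hausdorff] x)
    moreover have "M \<inter> {p \<in> topspace etop. p x \<in> {x}} = S"
      using M_carrier by (auto simp: S_def topspace_etop)
    ultimately show "closedin etop S" by simp
    show "S \<noteq> {}"
      using M_transitive[OF x x] by (auto simp: S_def)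
    show "p \<star> q \<in> S" if "p \<in> S" "q \<in> S" for p q
      using that x M_comp_M by (simp add: S_def compose_eq)
    show "p \<star> q \<star> r = p \<star> (q \<star> r)" if "p \<in> S" "q \<in> S" "r \<in> S" for p q r
      using that by (simp add: S_def M_assoc)
    show "continuous_map etop etop (\<lambda>p. p \<star> q)" if "q \<in> S" for q
      using that by (intro continuous_map_comp_right M_carrier) (simp add: S_def)
  qed
  then show thesis
    using that[of v] by (simp add: S_def)
qed

text \<open>Evaluation at x is a factor map from M onto X; this is how questions about cubes of X
  move to M.\<close>

lemma cubes_eq_MF_cubes:
  assumes x: "x \<in> topspace X"
  shows "cubes n = (\<lambda>c. \<lambda>\<omega>\<in>dcube n. c \<omega> x) ` MF.cubes n"
proof (rule cubes_factor_image)
  show "flow G Mtop Mact" "flow G X act"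
    by unfold_locales
  show "continuous_map Mtop X (\<lambda>m. m x)"
    unfolding Mtop_def using continuous_map_eval[OF x] by (rule continuous_map_from_subtopology)
  show "(\<lambda>m. m x) ` topspace Mtop = topspace X"
    using M_transitive[OF x] x by (force simp: topspace_Mtop)
  show "Mact g m x = act g (m x)" if "g \<in> carrier G" "m \<in> topspace Mtop" for g m
    using that x by (simp add: Mact_def topspace_Mtop compose_eq)
qed

section \<open>The group K and its description of NRP\<close>

definition KK :: "nat \<Rightarrow> ('a \<Rightarrow> 'a) set" where
  "KK n = {\<beta> \<in> carrier GG. lower_corner n u \<beta> \<in> MF.cubes n}"

lemma GG_M: "\<beta> \<in> carrier GG \<Longrightarrow> \<beta> \<in> M"
  by (simp add: carrier_GG)

lemma KK_iff: "\<beta> \<in> KK n \<longleftrightarrow> lower_corner n u \<beta> \<in> CC n"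
proof
  show "\<beta> \<in> KK n" if "lower_corner n u \<beta> \<in> CC n"
    using that CC_GG[OF that top_vertex_dcube] by (simp add: KK_def CC_def)
  show "lower_corner n u \<beta> \<in> CC n" if "\<beta> \<in> KK n"
    using that GG.one_closed by (intro CC_I) (auto simp: KK_def lower_corner_def)
qed

lemma subgroup_KK:
  assumes "n \<ge> 1"
  shows "subgroup (KK n) GG"
proof -
  interpret C: cube_group GG n "CC n"
    using assms by (rule cube_group_CC)
  show ?thesis
  proof (rule GG.subgroupI)
    show "KK n \<subseteq> carrier GG"
      by (auto simp: KK_def)
    have "lower_corner n u u = (\<lambda>\<omega>\<in>dcube n. \<one>\<^bsub>GG\<^esub>)"
      by (auto simp: lower_corner_def)
    then have "u \<in> KK n"
      using C.one_cubes by (simp add: KK_iff)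
    then show "KK n \<noteq> {}" by blast
    show "inv\<^bsub>GG\<^esub> \<beta> \<in> KK n" if "\<beta> \<in> KK n" for \<beta>
      using C.inv_cubes[of "lower_corner n u \<beta>"] that GG.inv_one by (simp add: KK_iff lower_corner_map)
    show "\<beta> \<otimes>\<^bsub>GG\<^esub> \<gamma> \<in> KK n" if "\<beta> \<in> KK n" "\<gamma> \<in> KK n" for \<beta> \<gamma>
    proof -
      have "(\<lambda>\<omega>\<in>dcube n. lower_corner n u \<beta> \<omega> \<otimes>\<^bsub>GG\<^esub> lower_corner n u \<gamma> \<omega>) = lower_corner n u (\<beta> \<star> \<gamma>)"
        using u_idem by (auto simp: lower_corner_def)
      then show ?thesis
        using C.mult_cubes[of "lower_corner n u \<beta>" "lower_corner n u \<gamma>"] that by (simp add: KK_iff)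
    qed
  qed
qed

lemma u_u [simp]: "x \<in> topspace X \<Longrightarrow> u (u x) = u x"
  by (rule comp_apply[OF u_idem])

lemma GG_u: "\<lbrakk>h \<in> carrier GG; x \<in> topspace X\<rbrakk> \<Longrightarrow> h (u x) = h x"
  using comp_apply[of h u h x] GG.r_one[of h] by simp

lemma GG_inv_apply: "\<lbrakk>h \<in> carrier GG; x \<in> topspace X\<rbrakk> \<Longrightarrow> (inv\<^bsub>GG\<^esub> h) (h x) = u x"
  using comp_apply[of "inv\<^bsub>GG\<^esub> h" h u x] GG.l_inv[of h] by simp

lemma subgroup_stabilizer_GG:
  assumes x: "x \<in> topspace X" and ux: "u x = x"
  shows "subgroup {h \<in> carrier GG. h x = x} GG"
proof (rule GG.subgroupI)
  show "{h \<in> carrier GG. h x = x} \<noteq> {}"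
    using ux GG.one_closed by auto
  show "inv\<^bsub>GG\<^esub> h \<in> {h \<in> carrier GG. h x = x}" if "h \<in> {h \<in> carrier GG. h x = x}" for h
    using that GG_inv_apply[of h x] x ux by simp
  show "h \<otimes>\<^bsub>GG\<^esub> k \<in> {h \<in> carrier GG. h x = x}"
    if "h \<in> {h \<in> carrier GG. h x = x}" "k \<in> {h \<in> carrier GG. h x = x}" for h k
    using that x GG.m_closed[of h k] by (simp add: compose_eq)
qed auto

text \<open>Left to right, u moves the corner to one based at \<open>u x\<close>, which lifts to a
  cube of u M whose entries off the top vertex fix \<open>u x\<close>; trivializing them leaves a
  lower corner in u M whose top entry is the required \<open>\<beta>\<close>. Right to left,
  evaluation at x gives the corner for \<open>u x\<close> and \<open>u y\<close>, and idempotents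
  fixing x and y undo the effect of u.\<close>

lemma NRP_iff:
  assumes x: "x \<in> topspace X" and y: "y \<in> topspace X"
  shows "(x, y) \<in> NRP G X act d \<longleftrightarrow> (\<exists>\<beta>\<in>KK (d + 1). u y = \<beta> (u x))"
proof
  define n where "n = d + 1"
  have n: "n \<ge> 1" by (simp add: n_def)
  interpret C: cube_group GG n "CC n"
    using n by (rule cube_group_CC)
  define x' where "x' = u x"
  have x': "x' \<in> topspace X" "u x' = x'"
    using x u_M by (simp_all add: x'_def)
  {
    assume "(x, y) \<in> NRP G X act d"
    then have "lower_corner n x y \<in> cubes n"
      by (simp add: NRP_def n_def)
    then have "lower_corner n x' (u y) \<in> cubes n"
      using cubes_env[OF M_env[OF u_M] _ n] by (simp add: x'_def flip: lower_corner_map)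
    then obtain c where c: "c \<in> MF.cubes n" and lc: "lower_corner n x' (u y) = (\<lambda>\<omega>\<in>dcube n. c \<omega> x')"
      using cubes_eq_MF_cubes[OF x'(1)] by auto
    have cx': "c \<omega> x' = lower_corner n x' (u y) \<omega>" if "\<omega> \<in> dcube n" for \<omega>
      using that by (simp add: lc)
    define e where "e = (\<lambda>\<omega>\<in>dcube n. u \<star> c \<omega>)"
    have e: "e \<in> CC n"
      unfolding e_def using c n by (rule u_comp_CC)
    have ex: "e \<omega> x' = x'" if "\<omega> \<in> dcube n" "\<omega> \<noteq> top_vertex n" for \<omega>
      using that cx'[OF that(1)] x' by (simp add: e_def lower_corner_def compose_eq)
    have etop: "e (top_vertex n) x' = u y"
      using cx'[OF top_vertex_dcube] x' y by (simp add: e_def top_vertex_dcube compose_eq)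
    \<comment> \<open>The base point was moved to \<open>u x\<close>, on which u is the identity, so
      that these elements form a subgroup of u M.\<close>
    define H where "H = {h \<in> carrier GG. h x' = x'}"
    have H: "subgroup H GG"
      unfolding H_def using x' by (rule subgroup_stabilizer_GG)
    have "\<exists>t\<in>CC n. (\<forall>\<omega>\<in>dcube n. t \<omega> \<in> H) \<and> (\<forall>\<omega>\<in>dcube n - {top_vertex n}. e \<omega> \<otimes>\<^bsub>GG\<^esub> t \<omega> = \<one>\<^bsub>GG\<^esub>)"
      using ex CC_GG[OF e] by (intro C.cube_trivialize[OF H e down_closed_proper]) (auto simp: H_def)
    then obtain t where t: "t \<in> CC n" "\<And>\<omega>. \<omega> \<in> dcube n \<Longrightarrow> t \<omega> \<in> H"
      "\<And>\<omega>. \<lbrakk>\<omega> \<in> dcube n; \<omega> \<noteq> top_vertex n\<rbrakk> \<Longrightarrow> e \<omega> \<star> t \<omega> = u"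
      by auto
    define \<beta> where "\<beta> = e (top_vertex n) \<star> t (top_vertex n)"
    have "(\<lambda>\<omega>\<in>dcube n. e \<omega> \<otimes>\<^bsub>GG\<^esub> t \<omega>) = lower_corner n u \<beta>"
      using t(3) by (intro lower_corner_eqI) (simp_all add: \<beta>_def top_vertex_dcube)
    then have "\<beta> \<in> KK n"
      using C.mult_cubes[OF e t(1)] by (simp add: KK_iff)
    \<comment> \<open>The top entry of t fixes \<open>u x\<close>, so multiplying by t does not
      change where e sends it.\<close>
    moreover have "\<beta> x' = u y"
      using t(2)[OF top_vertex_dcube] etop x' by (simp add: \<beta>_def H_def compose_eq)
    ultimately show "\<exists>\<beta>\<in>KK (d + 1). u y = \<beta> (u x)"
      unfolding n_def x'_def by (metis (no_types))
  }
  {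
    assume "\<exists>\<beta>\<in>KK (d + 1). u y = \<beta> (u x)"
    then obtain \<beta> where \<beta>: "\<beta> \<in> carrier GG" "lower_corner n u \<beta> \<in> MF.cubes n" "u y = \<beta> (u x)"
      by (auto simp: KK_def n_def)
    have "(\<lambda>\<omega>\<in>dcube n. lower_corner n u \<beta> \<omega> x) \<in> cubes n"
      unfolding cubes_eq_MF_cubes[OF x] using \<beta>(2) by (rule imageI)
    then have 1: "lower_corner n (u x) (u y) \<in> cubes n"
      using lower_corner_map[where n = n and f = "\<lambda>p. p x" and x = u and y = \<beta>] GG_u[OF \<beta>(1) x] \<beta>(3) by simp
    \<comment> \<open>First w at all vertices restores y; then v off the top vertex turns
      \<open>w (u x)\<close> into x, because \<open>w \<star> u = w\<close> and
      \<open>v \<star> w = v\<close>.\<close>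
    obtain v where v: "v \<in> M" "v \<star> v = v" "v x = x"
      using idem_fixing[OF x] .
    obtain w where w: "w \<in> M" "w \<star> w = w" "w y = y"
      using idem_fixing[OF y] .
    have wu: "w (u y) = y"
      using comp_apply[OF idem_right_identity[OF u_M u_idem w(1)] y] w(3) by simp
    have vwu: "v (w (u x)) = x"
      using comp_apply[OF idem_right_identity[OF u_M u_idem w(1)] x]
        comp_apply[OF idem_right_identity[OF w(1,2) v(1)] x] v(3) by simp
    have 2: "lower_corner n (w (u x)) y \<in> cubes n"
      using cubes_env[OF M_env[OF w(1)] 1 n] wu by (simp add: lower_corner_map)
    have "v (v z) = v z" if "z \<in> topspace X" for z
      using comp_apply[OF v(2) that] .
    note cubes_env_off_top[OF M_env[OF v(1)] this 2]
    moreover have "(\<lambda>\<omega>\<in>dcube n. if \<omega> = top_vertex n then lower_corner n (w (u x)) y \<omega>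
        else v (lower_corner n (w (u x)) y \<omega>)) = lower_corner n x y"
      using vwu by (auto simp: lower_corner_def)
    ultimately show "(x, y) \<in> NRP G X act d"
      using x y by (simp add: NRP_def n_def)
  }
qed

text \<open>Take u itself for \<open>\<beta>\<close>. It follows that u acts trivially on the
  quotient, so cubes there can be lifted to u M.\<close>

lemma NRP_u: "x \<in> topspace X \<Longrightarrow> (x, u x) \<in> NRP G X act d"
  using subgroup.one_closed[OF subgroup_KK[of "d + 1"]] u_M by (subst NRP_iff) (auto intro!: bexI[of _ u])

lemma equiv_NRP: "equiv (topspace X) (NRP G X act d)"
proof (rule equivI)
  let ?R = "NRP G X act d"
  have K: "subgroup (KK (d + 1)) GG"
    by (rule subgroup_KK) simp
  have KG: "\<beta> \<in> carrier GG" if "\<beta> \<in> KK (d + 1)" for \<beta>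
    using that by (simp add: KK_def)
  show sub: "?R \<subseteq> topspace X \<times> topspace X"
    by (auto simp: NRP_def)
  show "refl_on (topspace X) ?R"
  proof (rule refl_onI)
    show "(x, x) \<in> ?R" if "x \<in> topspace X" for x
      using that subgroup.one_closed[OF K] u_M by (subst NRP_iff) (auto intro!: bexI[of _ u])
  qed
  show "sym ?R"
  proof (rule symI)
    fix x y assume xy: "(x, y) \<in> ?R"
    then have top: "x \<in> topspace X" "y \<in> topspace X"
      by (auto simp: NRP_def)
    with xy obtain \<beta> where \<beta>: "\<beta> \<in> KK (d + 1)" "u y = \<beta> (u x)"
      by (auto simp: NRP_iff)
    have "(inv\<^bsub>GG\<^esub> \<beta>) (u y) = u x"
      using GG_inv_apply[OF KG[OF \<beta>(1)], of "u x"] \<beta>(2) top u_M by simp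
    then show "(y, x) \<in> ?R"
      using subgroup.m_inv_closed[OF K \<beta>(1)] top by (auto simp: NRP_iff intro!: bexI[of _ "inv\<^bsub>GG\<^esub> \<beta>"])
  qed
  show "trans ?R"
  proof (rule transI)
    fix x y z assume xy: "(x, y) \<in> ?R" and yz: "(y, z) \<in> ?R"
    then have top: "x \<in> topspace X" "y \<in> topspace X" "z \<in> topspace X"
      by (auto simp: NRP_def)
    with xy yz obtain \<beta> \<gamma> where \<beta>: "\<beta> \<in> KK (d + 1)" "u y = \<beta> (u x)" and \<gamma>: "\<gamma> \<in> KK (d + 1)" "u z = \<gamma> (u y)"
      by (auto simp: NRP_iff)
    have "u z = (\<gamma> \<star> \<beta>) (u x)"
      using \<beta>(2) \<gamma>(2) top u_M by (simp add: compose_eq)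
    then show "(x, z) \<in> ?R"
      using subgroup.m_closed[OF K \<gamma>(1) \<beta>(1)] top by (auto simp: NRP_iff)
  qed
qed

end

section \<open>Quotients by closed invariant equivalence relations\<close>

lemma tds_flow:
  assumes "tds G T X act"
  shows "flow G X act"
proof -
  have act: "group_action G (topspace X) act" "compact_space X" "Hausdorff_space X"
    and cont: "continuous_map (prod_topology T X) X (\<lambda>(g, x). act g x)"
    and T: "topspace T = carrier G"
    using assms by (auto simp: tds_def topological_group_def)
  have "continuous_map X X (act g)" if "g \<in> carrier G" for g
  proof -
    have "continuous_map X (prod_topology T X) (\<lambda>x. (g, x))"
      using that T by (simp add: continuous_map_pairedI)
    from continuous_map_compose[OF this cont] show ?thesis
      by (simp add: o_def)
  qed
  with act show ?thesis
    by (simp add: flow_def flow_axioms_def)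
qed

lemma quot_proj_eq_iff:
  "\<lbrakk>equiv (topspace X) R; x \<in> topspace X; y \<in> topspace X\<rbrakk> \<Longrightarrow> quot_proj R x = quot_proj R y \<longleftrightarrow> (x, y) \<in> R"
  unfolding quot_proj_def by (rule eq_equiv_class_iff)

lemma quot_proj_surj: "quot_proj R ` topspace X = topspace (quot_topology X R)"
  using quotient_map_quot_proj by (rule quotient_imp_surjective_map)

text \<open>The saturation of a closed set S is the second projection of the compact set
  \<open>R \<inter> S \<times> topspace X\<close>, hence closed.\<close>

lemma closed_map_quot_proj:
  assumes "compact_space X" "Hausdorff_space X" and R: "equiv (topspace X) R" "closedin (prod_topology X X) R"
  shows "closed_map X (quot_topology X R) (quot_proj R)"
proof (unfold closed_map_def, intro allI impI)
  fix S assume S: "closedin X S"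
  then have sub: "S \<subseteq> topspace X"
    by (rule closedin_subset)
  have "compact_space (prod_topology X X)"
    using assms(1) by (simp add: compact_space_prod_topology)
  moreover have "closedin (prod_topology X X) (R \<inter> S \<times> topspace X)"
    using S by (intro closedin_Int R(2)) (simp add: closedin_prod_Times_iff)
  ultimately have "compactin (prod_topology X X) (R \<inter> S \<times> topspace X)"
    by (rule closedin_compact_space)
  from image_compactin[OF this continuous_map_snd]
  have "closedin X (snd ` (R \<inter> S \<times> topspace X))"
    by (rule compactin_imp_closedin[OF assms(2)])
  also have "snd ` (R \<inter> S \<times> topspace X) = {x \<in> topspace X. quot_proj R x \<in> quot_proj R ` S}"
  proof (intro subset_antisym subsetI)
    fix y assume "y \<in> snd ` (R \<inter> S \<times> topspace X)"
    then obtain x where xy: "(x, y) \<in> R" "x \<in> S" "y \<in> topspace X"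
      by auto
    then have "quot_proj R y = quot_proj R x"
      using quot_proj_eq_iff[OF R(1), of x y] sub by (simp add: subset_iff)
    then show "y \<in> {x \<in> topspace X. quot_proj R x \<in> quot_proj R ` S}"
      using xy by simp
  next
    fix y assume "y \<in> {x \<in> topspace X. quot_proj R x \<in> quot_proj R ` S}"
    then obtain x where "y \<in> topspace X" "x \<in> S" "quot_proj R x = quot_proj R y"
      by auto
    then show "y \<in> snd ` (R \<inter> S \<times> topspace X)"
      using quot_proj_eq_iff[OF R(1), of x y] sub by (auto intro!: image_eqI[of _ snd "(x, y)"])
  qed
  finally have "closedin X {x \<in> topspace X. quot_proj R x \<in> quot_proj R ` S}" .
  moreover have "quot_proj R ` S \<subseteq> topspace (quot_topology X R)"
    using sub by (simp add: image_mono flip: quot_proj_surj)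
  ultimately show "closedin (quot_topology X R) (quot_proj R ` S)"
    using iffD1[OF quotient_map_closedin quotient_map_quot_proj[of X R]] by simp
qed

lemma factor_map_quot_proj:
  assumes tds: "tds G T X act" and R: "equiv (topspace X) R" "closedin (prod_topology X X) R"
    and inv: "\<And>g x y. \<lbrakk>g \<in> carrier G; (x, y) \<in> R\<rbrakk> \<Longrightarrow> (act g x, act g y) \<in> R"
  shows "factor_map G T X act (quot_topology X R) (quot_action X R act) (quot_proj R)"
proof -
  let ?Q = "quot_topology X R" and ?A = "quot_action X R act" and ?p = "quot_proj R"
  interpret flow G X act
    using tds by (rule tds_flow)
  have cont: "continuous_map X ?Q ?p"
    using quotient_map_quot_proj by (rule quotient_imp_continuous_map)
  have closed: "closed_map X ?Q ?p"
    using compact Hausdorff R by (rule closed_map_quot_proj)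
  have topQ: "topspace ?Q = topspace X // R"
    by (rule topspace_quot_topology)
  have p_Q: "?p x \<in> topspace ?Q" if "x \<in> topspace X" for x
    using that by (simp flip: quot_proj_surj)
  have p_subset: "?p x \<subseteq> topspace X" if "x \<in> topspace X" for x
    using equiv_type[OF R(1)] by (auto simp: quot_proj_def)
  have equi: "?A g (?p x) = ?p (act g x)" if g: "g \<in> carrier G" and x: "x \<in> topspace X" for g x
  proof -
    \<comment> \<open>Invariance alone maps a class into a class; the inverse of g shows that the
      whole class is reached.\<close>
    have "y \<in> act g ` ?p x" if y: "y \<in> ?p (act g x)" for y
    proof -
      have "y \<in> topspace X"
        using y p_subset[of "act g x"] g x by auto
      then have "act g (act (inv\<^bsub>G\<^esub> g) y) = y" "act (inv\<^bsub>G\<^esub> g) (act g x) = x"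
        using g x by (simp_all flip: composition_rule)
      moreover have "(act (inv\<^bsub>G\<^esub> g) (act g x), act (inv\<^bsub>G\<^esub> g) y) \<in> R"
        using y inv[of "inv\<^bsub>G\<^esub> g" "act g x" y] g by (simp add: quot_proj_def)
      ultimately show ?thesis
        by (intro image_eqI[of _ _ "act (inv\<^bsub>G\<^esub> g) y"]) (simp_all add: quot_proj_def)
    qed
    moreover have "act g ` ?p x \<subseteq> ?p (act g x)"
      using inv[OF g] by (auto simp: quot_proj_def)
    ultimately have "act g ` ?p x = ?p (act g x)"
      by blast
    then show ?thesis
      using p_Q[OF x] by (simp add: quot_action_def topQ)
  qed
  have p_cases: "\<exists>x\<in>topspace X. q = ?p x" if "q \<in> topspace ?Q" for q
    using that by (auto simp flip: quot_proj_surj)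
  have "group_action G (topspace ?Q) ?A"
  proof (rule group_actionI)
    show "group G" by (rule is_group)
    show "?A g \<in> extensional (topspace ?Q)" if "g \<in> carrier G" for g
      by (simp add: quot_action_def topQ)
    fix q assume "q \<in> topspace ?Q"
    then obtain x where x: "x \<in> topspace X" "q = ?p x"
      using p_cases by blast
    show "?A \<one>\<^bsub>G\<^esub> q = q"
      using x by (simp add: equi)
    fix g assume g: "g \<in> carrier G"
    show "?A g q \<in> topspace ?Q"
      using g x by (simp add: equi p_Q)
    fix h assume h: "h \<in> carrier G"
    show "?A (g \<otimes>\<^bsub>G\<^esub> h) q = ?A g (?A h q)"
      using g h x by (simp add: equi composition_rule)
  qed
  moreover have compQ: "compact_space ?Q"
    using image_compactin[OF _ cont, of "topspace X"] compact
    by (simp add: quot_proj_surj compact_space_def)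
  moreover have hausQ: "Hausdorff_space ?Q"
    using compact_Hausdorff_or_regular_imp_normal_space[OF compact] Hausdorff
      normal_Hausdorff_space_closed_continuous_map_image[OF _ Hausdorff closed cont quot_proj_surj] by simp
  moreover have "continuous_map (prod_topology T ?Q) ?Q (\<lambda>(g, q). ?A g q)"
  proof -
    \<comment> \<open>A product of a quotient map with the identity of T need not be a quotient map;
      a proper map stays closed under such products, so joint continuity descends.\<close>
    have "proper_map X ?Q ?p"
      using compact Hausdorff_imp_kc_space[OF hausQ] cont by (rule continuous_imp_proper_map)
    then have proper: "proper_map (prod_topology T X) (prod_topology T ?Q) (\<lambda>(g, x). (g, ?p x))"
      using proper_map_id[of T] by (simp add: proper_map_prod id_def)
    have quot: "quotient_map (prod_topology T X) (prod_topology T ?Q) (\<lambda>(g, x). (g, ?p x))"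
    proof (rule continuous_closed_imp_quotient_map)
      show "continuous_map (prod_topology T X) (prod_topology T ?Q) (\<lambda>(g, x). (g, ?p x))"
        unfolding case_prod_unfold
        by (intro continuous_map_pairedI continuous_map_fst continuous_map_compose[OF continuous_map_snd cont, unfolded o_def])
      show "closed_map (prod_topology T X) (prod_topology T ?Q) (\<lambda>(g, x). (g, ?p x))"
        using proper by (rule proper_imp_closed_map)
      show "(\<lambda>(g, x). (g, ?p x)) ` topspace (prod_topology T X) = topspace (prod_topology T ?Q)"
        by (force simp flip: quot_proj_surj)
    qed
    have "topspace T = carrier G" and act: "continuous_map (prod_topology T X) X (\<lambda>(g, x). act g x)"
      using tds by (auto simp: tds_def topological_group_def)
    have "continuous_map (prod_topology T X) ?Q ((\<lambda>(g, q). ?A g q) \<circ> (\<lambda>(g, x). (g, ?p x)))"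
    proof (rule continuous_map_eq)
      show "continuous_map (prod_topology T X) ?Q (?p \<circ> (\<lambda>(g, x). act g x))"
        by (rule continuous_map_compose[OF act cont])
    qed (auto simp: equi \<open>topspace T = carrier G\<close>)
    then show ?thesis
      by (rule continuous_compose_quotient_map[OF quot])
  qed
  ultimately have "tds G T ?Q ?A"
    using tds by (simp add: tds_def)
  then show ?thesis
    by (simp add: factor_map_def tds cont equi quot_proj_surj)
qed

text \<open>The order is the least s with uniqueness in dimension s + 1.\<close>

lemma nilspace_of_order_at_mostI:
  assumes "fibrant X C" "has_uniqueness C (d + 1)"
  shows "nilspace_of_order_at_most X C d"
proof -
  let ?s = "LEAST s. has_uniqueness C (s + 1)"
  have "has_uniqueness C (?s + 1)" "?s \<le> d"
    using assms(2) by (rule LeastI, rule Least_le)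
  moreover have "\<forall>t<?s. \<not> has_uniqueness C (t + 1)"
    using not_less_Least by blast
  ultimately show ?thesis
    unfolding nilspace_of_order_at_most_def nilspace_of_order_def using assms(1) by blast
qed

text \<open>One-sided inverse of \<open>face_incl\<close>: composing with it extends a cube given on
  a face to the whole discrete cube, constant in direction i.\<close>

definition del_coord :: "nat \<Rightarrow> nat \<Rightarrow> (nat \<Rightarrow> nat) \<Rightarrow> nat \<Rightarrow> nat" where
  "del_coord k i \<omega> = (\<lambda>j\<in>{1..k - 1}. if j < i then \<omega> j else \<omega> (j + 1))"

lemma cube_morphism_del_coord:
  assumes "i \<in> {1..k}"
  shows "cube_morphism k (k - 1) (del_coord k i)"
proof -
  have "\<exists>l\<in>{1..k}. \<forall>\<omega>\<in>dcube k. del_coord k i \<omega> j = \<omega> l" if "j \<in> {1..k - 1}" for j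
    using that assms by (intro bexI[of _ "if j < i then j else j + 1"]) (auto simp: del_coord_def)
  moreover have "del_coord k i \<omega> \<in> dcube (k - 1)" if "\<omega> \<in> dcube k" for \<omega>
    unfolding dcube_def
  proof (rule PiE_I)
    show "del_coord k i \<omega> j \<in> {0, 1}" if "j \<in> {1..k - 1}" for j
      using that assms dcube_cases[OF \<open>\<omega> \<in> dcube k\<close>, of j] dcube_cases[OF \<open>\<omega> \<in> dcube k\<close>, of "j + 1"]
      by (auto simp: del_coord_def)
  qed (auto simp: del_coord_def)
  ultimately show ?thesis
    by (simp add: cube_morphism_def)
qed

lemma face_incl_del_coord:
  assumes "\<omega> \<in> dcube k" "i \<in> {1..k}" "\<omega> i = 0"
  shows "face_incl k i (del_coord k i \<omega>) = \<omega>"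
proof (rule extensionalityI[of _ "{1..k}"])
  show "\<omega> \<in> extensional {1..k}"
    using assms by (simp add: dcube_def PiE_iff)
  show "face_incl k i (del_coord k i \<omega>) j = \<omega> j" if "j \<in> {1..k}" for j
    using that assms by (auto simp: face_incl_def del_coord_def)
qed (simp add: face_incl_def)

section \<open>The quotient by NRP is a nilspace\<close>

context minimal_ideal_flow
begin

lemma ergodic_cubes: "ergodic X cubes"
  unfolding ergodic_def
proof (intro subset_antisym subsetI)
  show "c \<in> topspace (cube_power X 1)" if "c \<in> cubes 1" for c
    using cubes_carrier[OF that] by (simp add: topspace_cube_power)
next
  fix c assume c: "c \<in> topspace (cube_power X 1)"
  let ?z = "\<lambda>i\<in>{1..1}. 0 :: nat" and ?F = "{\<omega> \<in> dcube 1. \<omega> 1 = 1}"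
  have z: "?z \<in> dcube 1"
    by (auto simp: dcube_def)
  have cX: "c \<omega> \<in> topspace X" if "\<omega> \<in> dcube 1" for \<omega>
    using c that by (auto simp: topspace_cube_power)
  \<comment> \<open>A pair of points is the constant cube at the first one with m applied on the
    upper hyperface.\<close>
  obtain m where m: "m \<in> M" "m (c ?z) = c (top_vertex 1)"
    using M_transitive[OF cX[OF z] cX[OF top_vertex_dcube]] by blast
  have "(\<lambda>\<omega>\<in>dcube 1. if \<omega> \<in> ?F then m ((\<lambda>\<omega>\<in>dcube 1. c ?z) \<omega>) else (\<lambda>\<omega>\<in>dcube 1. c ?z) \<omega>) \<in> cubes 1"
    by (intro cubes_env_face M_env m const_cubes cX z hyperface_mem) auto
  also have "(\<lambda>\<omega>\<in>dcube 1. if \<omega> \<in> ?F then m ((\<lambda>\<omega>\<in>dcube 1. c ?z) \<omega>) else (\<lambda>\<omega>\<in>dcube 1. c ?z) \<omega>)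
      = (\<lambda>\<omega>\<in>dcube 1. c \<omega>)"
  proof (rule restrict_ext)
    fix \<omega> assume \<omega>: "\<omega> \<in> dcube 1"
    have "\<omega> 1 = 0 \<or> \<omega> 1 = 1"
      using \<omega> by (intro dcube_cases) auto
    then show "(if \<omega> \<in> ?F then m ((\<lambda>\<omega>\<in>dcube 1. c ?z) \<omega>) else (\<lambda>\<omega>\<in>dcube 1. c ?z) \<omega>) = c \<omega>"
    proof (elim disjE)
      assume "\<omega> 1 = 1"
      then have "\<omega> = top_vertex 1"
        using dcube_neq_top_vertex_iff[OF \<omega>] by auto
      then show ?thesis
        using \<open>\<omega> 1 = 1\<close> \<omega> m(2) by simp
    next
      assume "\<omega> 1 = 0"
      then have "\<omega> = ?z"
        using \<omega> z by (intro extensionalityI[of _ "{1..1}"]) (auto simp: dcube_def PiE_iff)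
      then show ?thesis
        using \<open>\<omega> 1 = 0\<close> \<omega> by simp
    qed
  qed
  also have "\<dots> = c"
    using PiE_restrict[of c "dcube 1" "\<lambda>_. topspace X"] c by (simp add: topspace_cube_power)
  finally show "c \<in> cubes 1" .
qed

end

text \<open>Keeps of the quotient only an equivariant surjection whose fibres are the
  \<open>NRP\<close> classes, so that points need not be handled as sets.\<close>

locale NRP_quotient = minimal_ideal_flow G X act M u
  for G :: "('g, 'm) monoid_scheme" (structure) and X :: "'a topology" and act :: "'g \<Rightarrow> 'a \<Rightarrow> 'a"
    and M u +
  fixes d :: nat and Q :: "'q topology" and actQ :: "'g \<Rightarrow> 'q \<Rightarrow> 'q" and \<pi> :: "'a \<Rightarrow> 'q"
  assumes flow_Q: "flow G Q actQ"
    and continuous_\<pi>: "continuous_map X Q \<pi>" and \<pi>_surj: "\<pi> ` topspace X = topspace Q"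
    and \<pi>_act: "\<lbrakk>g \<in> carrier G; x \<in> topspace X\<rbrakk> \<Longrightarrow> \<pi> (act g x) = actQ g (\<pi> x)"
    and \<pi>_eq_iff: "\<lbrakk>x \<in> topspace X; y \<in> topspace X\<rbrakk> \<Longrightarrow> \<pi> x = \<pi> y \<longleftrightarrow> (x, y) \<in> NRP G X act d"
begin

sublocale Q: flow G Q actQ
  by (rule flow_Q)

text \<open>Elements of \<open>env\<close> preserve \<open>NRP\<close>, so even discontinuous ones
  induce maps on Q.\<close>

lemma \<pi>_env:
  "\<lbrakk>p \<in> env; x \<in> topspace X; y \<in> topspace X; \<pi> x = \<pi> y\<rbrakk> \<Longrightarrow> \<pi> (p x) = \<pi> (p y)"
  by (simp add: \<pi>_eq_iff NRP_env)

lemma \<pi>_u: "x \<in> topspace X \<Longrightarrow> \<pi> (u x) = \<pi> x"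
  using NRP_u[of x d] \<pi>_eq_iff[of x "u x"] u_M by simp

lemma Q_cubes_eq: "Q.cubes n = (\<lambda>c. \<lambda>\<omega>\<in>dcube n. \<pi> (c \<omega>)) ` cubes n"
  using flow_axioms flow_Q continuous_\<pi> \<pi>_surj \<pi>_act by (rule cubes_factor_image)

lemma ergodic_Q: "ergodic Q Q.cubes"
  unfolding ergodic_def
proof (intro subset_antisym subsetI)
  show "c \<in> topspace (cube_power Q 1)" if "c \<in> Q.cubes 1" for c
    using Q.cubes_carrier[OF that] by (simp add: topspace_cube_power)
next
  fix c assume c: "c \<in> topspace (cube_power Q 1)"
  define b where "b = (\<lambda>\<omega>\<in>dcube 1. SOME x. x \<in> topspace X \<and> \<pi> x = c \<omega>)"
  have b: "b \<omega> \<in> topspace X \<and> \<pi> (b \<omega>) = c \<omega>" if "\<omega> \<in> dcube 1" for \<omega>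
  proof -
    have "c \<omega> \<in> \<pi> ` topspace X"
      using c that by (auto simp: topspace_cube_power \<pi>_surj)
    then have "\<exists>x. x \<in> topspace X \<and> \<pi> x = c \<omega>"
      by auto
    from someI_ex[OF this] show ?thesis
      using that by (simp add: b_def)
  qed
  then have "b \<in> topspace (cube_power X 1)"
    by (simp add: topspace_cube_power PiE_iff b_def)
  then have "b \<in> cubes 1"
    using ergodic_cubes by (simp add: ergodic_def)
  moreover have "c = (\<lambda>\<omega>\<in>dcube 1. \<pi> (b \<omega>))"
    using c b by (intro extensionalityI[of _ "dcube 1"]) (simp_all add: topspace_cube_power PiE_iff)
  ultimately show "c \<in> Q.cubes 1"
    unfolding Q_cubes_eq by (intro image_eqI)
qed

text \<open>Left multiplication by u carries cubes of M into \<open>CC n\<close> and is invisible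
  after \<open>\<pi>\<close>.\<close>

lemma Q_cubes_CC:
  assumes x: "x \<in> topspace X" and n: "n \<ge> 1"
  shows "Q.cubes n = (\<lambda>a. \<lambda>\<omega>\<in>dcube n. \<pi> (a \<omega> x)) ` CC n"
proof -
  let ?f = "\<lambda>a. \<lambda>\<omega>\<in>dcube n. \<pi> (a \<omega> x)"
  have "Q.cubes n = ?f ` MF.cubes n"
    unfolding Q_cubes_eq cubes_eq_MF_cubes[OF x] image_image by (intro image_cong restrict_ext) auto
  also have "\<dots> = ?f ` CC n"
  proof (intro subset_antisym image_subsetI)
    fix c assume c: "c \<in> MF.cubes n"
    have "\<pi> (c \<omega> x) = \<pi> ((u \<star> c \<omega>) x)" if "\<omega> \<in> dcube n" for \<omega>
      using \<pi>_u MF_cubes_M[OF c that] x by (simp add: compose_eq)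
    then have "?f c = ?f (\<lambda>\<omega>\<in>dcube n. u \<star> c \<omega>)"
      by (intro restrict_ext) simp
    then show "?f c \<in> ?f ` CC n"
      using u_comp_CC[OF c n] by (rule image_eqI)
  next
    show "?f c \<in> ?f ` MF.cubes n" if "c \<in> CC n" for c
      using CC_cubes[OF that] by (rule imageI)
  qed
  finally show ?thesis .
qed

text \<open>The stabilizer in u M of the point \<open>\<pi> x\<close>, known as the Ellis group of Q
  at that point.\<close>

definition HH :: "'a \<Rightarrow> ('a \<Rightarrow> 'a) set" where
  "HH x = {h \<in> carrier GG. \<pi> (h x) = \<pi> x}"

lemma GG_env: "h \<in> carrier GG \<Longrightarrow> h \<in> env"
  by (simp add: GG_M M_env)

lemma GG_closed [simp]: "\<lbrakk>h \<in> carrier GG; x \<in> topspace X\<rbrakk> \<Longrightarrow> h x \<in> topspace X"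
  by (simp add: GG_M)

lemma subgroup_HH:
  assumes x: "x \<in> topspace X"
  shows "subgroup (HH x) GG"
proof (rule GG.subgroupI)
  show "HH x \<subseteq> carrier GG"
    by (auto simp: HH_def)
  have "u \<in> HH x"
    using GG.one_closed \<pi>_u x by (simp add: HH_def)
  then show "HH x \<noteq> {}" by blast
  show "inv\<^bsub>GG\<^esub> h \<in> HH x" if "h \<in> HH x" for h
  proof -
    have h: "h \<in> carrier GG" "\<pi> (h x) = \<pi> x"
      using that by (auto simp: HH_def)
    have "\<pi> ((inv\<^bsub>GG\<^esub> h) (h x)) = \<pi> ((inv\<^bsub>GG\<^esub> h) x)"
      using h x by (intro \<pi>_env[of "inv\<^bsub>GG\<^esub> h" "h x" x]) (simp_all add: GG_env)
    then show ?thesis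
      using h(1) x GG_inv_apply[OF h(1) x] \<pi>_u by (simp add: HH_def)
  qed
  show "h \<otimes>\<^bsub>GG\<^esub> k \<in> HH x" if "h \<in> HH x" "k \<in> HH x" for h k
  proof -
    have h: "h \<in> carrier GG" "\<pi> (h x) = \<pi> x" and k: "k \<in> carrier GG" "\<pi> (k x) = \<pi> x"
      using that by (auto simp: HH_def)
    have "\<pi> (h (k x)) = \<pi> (h x)"
      using h k x by (intro \<pi>_env[of h "k x" x]) (simp_all add: GG_env)
    then show ?thesis
      using h k x GG.m_closed[of h k] by (simp add: HH_def compose_eq)
  qed
qed

text \<open>Elements of u M respect the fibres of \<open>\<pi>\<close>, so a can be cancelled. This
  is the coset premise of \<open>cube_completion\<close> for the map sending a to
  \<open>\<pi> (a x)\<close>.\<close>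

lemma \<pi>_eq_HH:
  assumes x: "x \<in> topspace X" and a: "a \<in> carrier GG" and b: "b \<in> carrier GG"
  shows "\<pi> (a x) = \<pi> (b x) \<longleftrightarrow> inv\<^bsub>GG\<^esub> a \<otimes>\<^bsub>GG\<^esub> b \<in> HH x"
proof -
  have ia: "inv\<^bsub>GG\<^esub> a \<in> carrier GG" using a by simp
  have ab: "inv\<^bsub>GG\<^esub> a \<star> b \<in> carrier GG"
    using GG.m_closed[OF ia b] by simp
  have "a \<star> (inv\<^bsub>GG\<^esub> a \<star> b) = b"
    using GG.inv_solve_left[of b "inv\<^bsub>GG\<^esub> a" "inv\<^bsub>GG\<^esub> a \<otimes>\<^bsub>GG\<^esub> b"] a b ab by simp
  then have 1: "a ((inv\<^bsub>GG\<^esub> a) (b x)) = b x"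
    using comp_apply[of a "inv\<^bsub>GG\<^esub> a \<star> b" b x] x by (simp add: compose_eq)
  have "\<pi> (a x) = \<pi> (b x) \<longleftrightarrow> \<pi> ((inv\<^bsub>GG\<^esub> a) (b x)) = \<pi> x"
  proof
    assume "\<pi> (a x) = \<pi> (b x)"
    then have "\<pi> ((inv\<^bsub>GG\<^esub> a) (a x)) = \<pi> ((inv\<^bsub>GG\<^esub> a) (b x))"
      using a b x by (intro \<pi>_env[of "inv\<^bsub>GG\<^esub> a" "a x" "b x"]) (simp_all add: GG_env)
    then show "\<pi> ((inv\<^bsub>GG\<^esub> a) (b x)) = \<pi> x"
      using GG_inv_apply[OF a x] \<pi>_u[OF x] by simp
  next
    assume "\<pi> ((inv\<^bsub>GG\<^esub> a) (b x)) = \<pi> x"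
    then have "\<pi> (a ((inv\<^bsub>GG\<^esub> a) (b x))) = \<pi> (a x)"
      using a b x by (intro \<pi>_env[of a "(inv\<^bsub>GG\<^esub> a) (b x)" x]) (simp_all add: GG_env)
    then show "\<pi> (a x) = \<pi> (b x)"
      using 1 by simp
  qed
  then show ?thesis
    using ab x by (simp add: HH_def compose_eq)
qed

text \<open>Since u is neutral on both sides of \<open>\<beta>\<close>,
  \<open>u (\<beta> x) = \<beta> (u x)\<close>, and \<open>NRP_iff\<close> relates x to
  \<open>\<beta> x\<close>. One and the same K thus fixes all points of Q.\<close>

lemma KK_HH:
  assumes x: "x \<in> topspace X"
  shows "KK (d + 1) \<subseteq> HH x"
proof
  fix \<beta> assume \<beta>: "\<beta> \<in> KK (d + 1)"
  then have "\<beta> \<in> carrier GG"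
    by (simp add: KK_def)
  moreover from this have "u \<star> \<beta> = \<beta>"
    by (simp add: carrier_GG)
  then have "u (\<beta> x) = \<beta> (u x)"
    using comp_apply[of u \<beta> \<beta> x] x GG_u[OF \<open>\<beta> \<in> carrier GG\<close> x] by simp
  then have "(x, \<beta> x) \<in> NRP G X act d"
    using \<beta> x \<open>\<beta> \<in> carrier GG\<close> by (subst NRP_iff) auto
  ultimately show "\<beta> \<in> HH x"
    using \<pi>_eq_iff[of x "\<beta> x"] x by (simp add: HH_def)
qed

text \<open>X may be empty, so a base point has to be drawn from a value of a given cube or
  corner.\<close>

lemma Q_point:
  assumes "q \<in> topspace Q"
  obtains x where "x \<in> topspace X"
proof -
  have "q \<in> \<pi> ` topspace X"
    using assms by (simp add: \<pi>_surj)
  then show thesis using that by auto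
qed

text \<open>Lift both cubes to u M and let e be their quotient, which lies in \<open>HH x\<close>
  off the top vertex. After trivialization its top entry is in K, hence in \<open>HH x\<close> by
  \<open>KK_HH\<close>; undoing the correction stays in \<open>HH x\<close>, so the top values agree
  too.\<close>

lemma uniqueness_Q: "has_uniqueness Q.cubes (d + 1)"
  unfolding has_uniqueness_def
proof (intro ballI impI)
  define n where "n = d + 1"
  have n: "n \<ge> 1" by (simp add: n_def)
  fix c c' assume c: "c \<in> Q.cubes (d + 1)" and c': "c' \<in> Q.cubes (d + 1)"
    and agree: "\<forall>\<omega>\<in>dcube (d + 1) - {top_vertex (d + 1)}. c \<omega> = c' \<omega>"
  note cc = c[folded n_def] c'[folded n_def] agree[folded n_def]
  obtain x where x: "x \<in> topspace X"
    using Q_point[OF Q.cubes_closed[OF c top_vertex_dcube]] .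
  interpret C: cube_group GG n "CC n"
    using n by (rule cube_group_CC)
  obtain a a' where a: "a \<in> CC n" "c = (\<lambda>\<omega>\<in>dcube n. \<pi> (a \<omega> x))"
    and a': "a' \<in> CC n" "c' = (\<lambda>\<omega>\<in>dcube n. \<pi> (a' \<omega> x))"
    using cc unfolding Q_cubes_CC[OF x n] by auto
  define e where "e = (\<lambda>\<omega>\<in>dcube n. (\<lambda>\<omega>\<in>dcube n. inv\<^bsub>GG\<^esub> a \<omega>) \<omega> \<otimes>\<^bsub>GG\<^esub> a' \<omega>)"
  have e: "e \<in> CC n"
    unfolding e_def by (intro C.mult_cubes C.inv_cubes a a')
  have eq_iff: "c \<omega> = c' \<omega> \<longleftrightarrow> e \<omega> \<in> HH x" if "\<omega> \<in> dcube n" for \<omega>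
    using that \<pi>_eq_HH[OF x CC_GG[OF a(1) that] CC_GG[OF a'(1) that]] by (simp add: a(2) a'(2) e_def)
  have "\<exists>t\<in>CC n. (\<forall>\<omega>\<in>dcube n. t \<omega> \<in> HH x) \<and> (\<forall>\<omega>\<in>dcube n - {top_vertex n}. e \<omega> \<otimes>\<^bsub>GG\<^esub> t \<omega> = \<one>\<^bsub>GG\<^esub>)"
  proof (rule C.cube_trivialize[OF subgroup_HH[OF x] e down_closed_proper])
    show "e \<omega> \<in> HH x" if "\<omega> \<in> dcube n - {top_vertex n}" for \<omega>
      using that cc(3) eq_iff[of \<omega>] by auto
  qed
  then obtain t where t: "t \<in> CC n" "\<And>\<omega>. \<omega> \<in> dcube n \<Longrightarrow> t \<omega> \<in> HH x"
    "\<And>\<omega>. \<lbrakk>\<omega> \<in> dcube n; \<omega> \<noteq> top_vertex n\<rbrakk> \<Longrightarrow> e \<omega> \<otimes>\<^bsub>GG\<^esub> t \<omega> = \<one>\<^bsub>GG\<^esub>"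
    by auto
  let ?w = "top_vertex n"
  define \<beta> where "\<beta> = e ?w \<otimes>\<^bsub>GG\<^esub> t ?w"
  have "(\<lambda>\<omega>\<in>dcube n. e \<omega> \<otimes>\<^bsub>GG\<^esub> t \<omega>) = lower_corner n u \<beta>"
    using t(3) by (intro lower_corner_eqI) (simp_all add: \<beta>_def top_vertex_dcube)
  then have "\<beta> \<in> KK n"
    using C.mult_cubes[OF e t(1)] by (simp add: KK_iff)
  then have "\<beta> \<in> HH x"
    using KK_HH[OF x] by (auto simp: n_def)
  then have "\<beta> \<otimes>\<^bsub>GG\<^esub> inv\<^bsub>GG\<^esub> (t ?w) \<in> HH x"
    using t(2)[OF top_vertex_dcube] subgroup_HH[OF x] by (simp add: subgroup.m_closed subgroup.m_inv_closed del: mult_GG)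
  moreover have "\<beta> \<otimes>\<^bsub>GG\<^esub> inv\<^bsub>GG\<^esub> (t ?w) = e ?w"
    using CC_GG[OF e top_vertex_dcube] CC_GG[OF t(1) top_vertex_dcube]
    by (simp add: \<beta>_def GG.m_assoc del: mult_GG one_GG)
  ultimately have "e ?w \<in> HH x" by simp
  then have "c ?w = c' ?w"
    by (simp add: eq_iff top_vertex_dcube)
  show "c = c'"
  proof (rule extensionalityI[of _ "dcube n"])
    show "c \<omega> = c' \<omega>" if "\<omega> \<in> dcube n" for \<omega>
      using that cc(3) \<open>c ?w = c' ?w\<close> by (cases "\<omega> = ?w") auto
  qed (simp_all add: a(2) a'(2))
qed

lemma completion_Q:
  assumes k: "k \<ge> 1"
  shows "has_completion Q Q.cubes k"
  unfolding has_completion_def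
proof (intro allI impI)
  fix f assume "corner Q Q.cubes k f"
  then have f: "f \<in> dcube k - {top_vertex k} \<rightarrow>\<^sub>E topspace Q"
    and faces: "\<And>i. i \<in> {1..k} \<Longrightarrow> (\<lambda>\<omega>\<in>dcube (k - 1). f (face_incl k i \<omega>)) \<in> Q.cubes (k - 1)"
    by (auto simp: corner_def)
  \<comment> \<open>The bottom vertex belongs to the corner because k is positive; the value there
    supplies a base point.\<close>
  let ?z = "\<lambda>i\<in>{1..k}. 0 :: nat"
  have z: "?z \<in> dcube k"
    by (auto simp: dcube_def)
  have "\<exists>i\<in>{1..k}. ?z i = 0"
    using k by (intro bexI[of _ 1]) auto
  then have "?z \<in> dcube k - {top_vertex k}"
    using z dcube_neq_top_vertex_iff[OF z] by simp
  then have "f ?z \<in> topspace Q"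
    using f by (rule PiE_mem[rotated])
  then obtain x where x: "x \<in> topspace X"
    by (rule Q_point)
  interpret C: cube_group GG k "CC k"
    using k by (rule cube_group_CC)
  have "\<exists>a\<in>CC k. \<forall>\<omega>\<in>dcube k - {top_vertex k}. \<pi> (a \<omega> x) = f \<omega>"
  proof (rule C.cube_completion[OF subgroup_HH[OF x] \<pi>_eq_HH[OF x]])
    fix \<omega> assume \<omega>: "\<omega> \<in> dcube k" "\<omega> \<noteq> top_vertex k"
    then obtain i where i: "i \<in> {1..k}" "\<omega> i = 0"
      using dcube_neq_top_vertex_iff[OF \<omega>(1)] by auto
    \<comment> \<open>All vertices below \<open>\<omega>\<close> lie in the face where coordinate i
      is 0, and there the corner is a cube; extended along direction i and precomposed with the
      retraction, it becomes a k-cube with value \<open>f (inf \<omega>' \<omega>)\<close> at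
      \<open>\<omega>'\<close>.\<close>
    let ?c = "\<lambda>\<omega>\<in>dcube (k - 1). f (face_incl k i \<omega>)"
    have "compose (dcube k) (compose (dcube k) ?c (del_coord k i)) (\<lambda>\<omega>'. inf \<omega>' \<omega>) \<in> Q.cubes k"
      by (intro Q.compose_cubes[OF cube_morphism_inf[OF \<omega>(1)]] Q.compose_cubes[OF cube_morphism_del_coord[OF i(1)]] faces i)
    then obtain b where b: "b \<in> CC k"
      "compose (dcube k) (compose (dcube k) ?c (del_coord k i)) (\<lambda>\<omega>'. inf \<omega>' \<omega>) = (\<lambda>\<omega>\<in>dcube k. \<pi> (b \<omega> x))"
      unfolding Q_cubes_CC[OF x k] by auto
    have "\<pi> (b \<omega>' x) = f (inf \<omega>' \<omega>)" if \<omega>': "\<omega>' \<in> dcube k" for \<omega>'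
    proof -
      have inf: "inf \<omega>' \<omega> \<in> dcube k" "inf \<omega>' \<omega> i = 0"
        using inf_dcube[OF \<omega>' \<omega>(1)] i(2) by (simp_all add: inf_nat_def)
      have "del_coord k i (inf \<omega>' \<omega>) \<in> dcube (k - 1)"
        using cube_morphism_del_coord[OF i(1)] inf(1) by (auto simp: cube_morphism_def)
      then have "compose (dcube k) (compose (dcube k) ?c (del_coord k i)) (\<lambda>\<omega>'. inf \<omega>' \<omega>) \<omega>' = f (inf \<omega>' \<omega>)"
        using \<omega>' inf face_incl_del_coord[OF inf(1) i(1) inf(2)]
        by (simp add: compose_eq del: inf_apply)
      then have "(\<lambda>\<omega>\<in>dcube k. \<pi> (b \<omega> x)) \<omega>' = f (inf \<omega>' \<omega>)"
        by (simp only: b(2))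
      then show ?thesis
        using \<omega>' by simp
    qed
    then show "\<exists>b\<in>CC k. \<forall>\<omega>'\<in>dcube k. \<pi> (b \<omega>' x) = f (inf \<omega>' \<omega>)"
      using b(1) by blast
  qed
  then obtain a where a: "a \<in> CC k" "\<And>\<omega>. \<omega> \<in> dcube k - {top_vertex k} \<Longrightarrow> \<pi> (a \<omega> x) = f \<omega>"
    by auto
  let ?a = "\<lambda>\<omega>\<in>dcube k. \<pi> (a \<omega> x)"
  have "restrict ?a (dcube k - {top_vertex k}) = f"
  proof (rule extensionalityI[OF restrict_extensional])
    show "f \<in> extensional (dcube k - {top_vertex k})"
      using f by (simp add: PiE_iff)
  qed (simp add: a(2))
  moreover have "?a \<in> Q.cubes k"
    unfolding Q_cubes_CC[OF x k] using a(1) by (rule imageI)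
  ultimately show "\<exists>c\<in>Q.cubes k. restrict c (dcube k - {top_vertex k}) = f" ..
qed

lemma nilspace_Q: "nilspace_of_order_at_most Q Q.cubes d"
  using Q.cubespace_cubes completion_Q uniqueness_Q
  by (intro nilspace_of_order_at_mostI) (simp_all add: fibrant_def)

end

section \<open>Maximality\<close>

text \<open>A lower corner in dimension d + 1 restricts to one in dimension s + 1 on the face
  through the top vertex where the last d - s coordinates are 1, and there uniqueness compares it
  with the constant cube.\<close>

lemma lower_corner_uniqueness:
  assumes "cubespace Y C" "has_uniqueness C (s + 1)" "s \<le> d"
    and yy': "lower_corner (d + 1) y y' \<in> C (d + 1)" and yy: "lower_corner (d + 1) y y \<in> C (d + 1)"
  shows "y = y'"
proof -
  \<comment> \<open>Padding with 1, not 0, makes the top vertex correspond to the top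
    vertex.\<close>
  define f where "f = (\<lambda>\<omega>. \<lambda>j\<in>{1..d + 1}. if j \<le> s + 1 then \<omega> j else (1 :: nat))"
  have f_dcube: "f \<omega> \<in> dcube (d + 1)" if "\<omega> \<in> dcube (s + 1)" for \<omega>
    unfolding dcube_def
  proof (rule PiE_I)
    show "f \<omega> j \<in> {0, 1}" if "j \<in> {1..d + 1}" for j
      using that dcube_cases[OF \<open>\<omega> \<in> dcube (s + 1)\<close>, of j] by (auto simp: f_def)
  qed (auto simp: f_def)
  have "cube_morphism (s + 1) (d + 1) f"
    unfolding cube_morphism_def
  proof (intro conjI ballI)
    show "f \<in> dcube (s + 1) \<rightarrow> dcube (d + 1)"
      using f_dcube by simp
    fix j assume j: "j \<in> {1..d + 1}"
    show "(\<forall>\<omega>\<in>dcube (s + 1). f \<omega> j = 0) \<or> (\<forall>\<omega>\<in>dcube (s + 1). f \<omega> j = 1) \<or>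
        (\<exists>i\<in>{1..s + 1}. \<forall>\<omega>\<in>dcube (s + 1). f \<omega> j = \<omega> i) \<or>
        (\<exists>i\<in>{1..s + 1}. \<forall>\<omega>\<in>dcube (s + 1). f \<omega> j = 1 - \<omega> i)"
    proof (cases "j \<le> s + 1")
      case True
      then show ?thesis
        using j by (intro disjI2 disjI1 bexI[of _ j]) (auto simp: f_def)
    next
      case False
      then show ?thesis
        using j by (intro disjI2 disjI1) (simp add: f_def)
    qed
  qed
  then have C: "compose (dcube (s + 1)) c f \<in> C (s + 1)" if "c \<in> C (d + 1)" for c
    using that assms(1) by (auto simp: cubespace_def)
  have top_iff: "f \<omega> = top_vertex (d + 1) \<longleftrightarrow> \<omega> = top_vertex (s + 1)" if \<omega>: "\<omega> \<in> dcube (s + 1)" for \<omega>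
  proof -
    have "(\<exists>j\<in>{1..d + 1}. f \<omega> j = 0) \<longleftrightarrow> (\<exists>i\<in>{1..s + 1}. \<omega> i = 0)"
    proof
      assume "\<exists>j\<in>{1..d + 1}. f \<omega> j = 0"
      then obtain j where "j \<in> {1..d + 1}" "f \<omega> j = 0" by auto
      then show "\<exists>i\<in>{1..s + 1}. \<omega> i = 0"
        by (intro bexI[of _ j]) (auto simp: f_def split: if_splits)
    next
      assume "\<exists>i\<in>{1..s + 1}. \<omega> i = 0"
      then obtain i where "i \<in> {1..s + 1}" "\<omega> i = 0" by auto
      then show "\<exists>j\<in>{1..d + 1}. f \<omega> j = 0"
        using \<open>s \<le> d\<close> by (intro bexI[of _ i]) (auto simp: f_def)
    qed
    then show ?thesis
      using dcube_neq_top_vertex_iff[OF \<omega>] dcube_neq_top_vertex_iff[OF f_dcube[OF \<omega>]] by argo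
  qed
  have lc: "compose (dcube (s + 1)) (lower_corner (d + 1) y z) f = lower_corner (s + 1) y z" for z
    unfolding compose_def lower_corner_def[of "s + 1"]
    by (intro restrict_ext) (simp add: lower_corner_def f_dcube[simplified] top_iff[simplified])
  have "\<forall>\<omega>\<in>dcube (s + 1) - {top_vertex (s + 1)}. lower_corner (s + 1) y y \<omega> = lower_corner (s + 1) y y' \<omega>"
    by (simp add: lower_corner_def)
  then have "lower_corner (s + 1) y y = lower_corner (s + 1) y y'"
    using assms(2) C[OF yy] C[OF yy'] unfolding has_uniqueness_def lc by (simp del: One_nat_def)
  from fun_cong[OF this, of "top_vertex (s + 1)"] show ?thesis
    by simp
qed

text \<open>Factor maps send cubes to cubes, so the corner for x and y becomes a corner in Y, where
  uniqueness collapses it.\<close>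

lemma factor_map_NRP:
  assumes "factor_map G T X act Y actY \<phi>" "nilspace_of_order_at_most Y (dyn_cubes G Y actY) d"
    and xy: "(x, y) \<in> NRP G X act d"
  shows "\<phi> x = \<phi> y"
proof -
  have fm: "continuous_map X Y \<phi>" "\<phi> ` topspace X = topspace Y"
    and equi: "\<And>g x. \<lbrakk>g \<in> carrier G; x \<in> topspace X\<rbrakk> \<Longrightarrow> \<phi> (act g x) = actY g (\<phi> x)"
    and tds: "tds G T X act" "tds G T Y actY"
    using assms(1) by (auto simp: factor_map_def)
  interpret X: flow G X act using tds(1) by (rule tds_flow)
  interpret Y: flow G Y actY using tds(2) by (rule tds_flow)
  have x: "x \<in> topspace X" and lc: "lower_corner (d + 1) x y \<in> X.cubes (d + 1)"
    using xy by (auto simp: NRP_def)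
  have "(\<lambda>\<omega>\<in>dcube (d + 1). x) = lower_corner (d + 1) x x"
    by (auto simp: lower_corner_def)
  then have xx: "lower_corner (d + 1) x x \<in> X.cubes (d + 1)"
    using X.const_cubes[OF x, of "d + 1"] by simp
  have Y_cubes: "Y.cubes (d + 1) = (\<lambda>c. \<lambda>\<omega>\<in>dcube (d + 1). \<phi> (c \<omega>)) ` X.cubes (d + 1)"
    using X.flow_axioms Y.flow_axioms fm equi by (rule cubes_factor_image)
  have "lower_corner (d + 1) (\<phi> x) (\<phi> z) \<in> Y.cubes (d + 1)"
    if "lower_corner (d + 1) x z \<in> X.cubes (d + 1)" for z
    unfolding Y_cubes
    by (rule image_eqI[where x = "lower_corner (d + 1) x z"]) (simp_all only: lower_corner_map[where f = \<phi>] that)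
  note image = this
  obtain s where s: "s \<le> d" "has_uniqueness Y.cubes (s + 1)"
    using assms(2) by (auto simp: nilspace_of_order_at_most_def nilspace_of_order_def)
  show ?thesis
    by (rule lower_corner_uniqueness[OF Y.cubespace_cubes s(2,1) image[OF lc] image[OF xx]])
qed

theorem theorem7p15:
  fixes G :: "('g, 'm) monoid_scheme" and T :: "'g topology"
    and X :: "'a topology" and act :: "'g \<Rightarrow> 'a \<Rightarrow> 'a" and d :: nat
  assumes "d \<ge> 1" and "minimal_tds G T X act"
  shows "let R = NRP G X act d;
             Q = quot_topology X R;
             actQ = quot_action X R act;
             \<pi> = quot_proj R
         in factor_map G T X act Q actQ \<pi> \<and>
            ergodic Q (dyn_cubes G Q actQ) \<and>
            nilspace_of_order_at_most Q (dyn_cubes G Q actQ) d \<and>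
            (\<forall>(Y :: 'b topology) actY \<phi>.
               factor_map G T X act Y actY \<phi> \<and>
               ergodic Y (dyn_cubes G Y actY) \<and>
               nilspace_of_order_at_most Y (dyn_cubes G Y actY) d \<longrightarrow>
               (\<exists>\<psi>. factor_map G T Q actQ Y actY \<psi> \<and>
                    (\<forall>x\<in>topspace X. \<phi> x = \<psi> (\<pi> x))))"
proof -
  define R where "R = NRP G X act d"
  define Q where "Q = quot_topology X R"
  define actQ where "actQ = quot_action X R act"
  define \<pi> where "\<pi> = quot_proj R"
  have tds: "tds G T X act" and min: "\<And>x. x \<in> topspace X \<Longrightarrow> X closure_of orbit G act x = topspace X"
    using assms(2) by (auto simp: minimal_tds_def)
  interpret F: flow G X act
    using tds by (rule tds_flow)
  obtain M where M: "F.left_ideal M" "\<And>S. \<lbrakk>F.left_ideal S; S \<subseteq> M\<rbrakk> \<Longrightarrow> S = M"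
    by (rule F.minimal_left_ideal_exists) (rule that)
  have M_props: "closedin F.etop M" "M \<noteq> {}" "M \<subseteq> F.env" "\<And>p q. \<lbrakk>p \<in> F.env; q \<in> M\<rbrakk> \<Longrightarrow> F.comp p q \<in> M"
    using M(1) by (auto simp: F.left_ideal_def)
  obtain u where u: "u \<in> M" "F.comp u u = u"
  proof (rule idempotent_exists[OF F.compact_space_etop F.Hausdorff_space_etop M_props(1,2), where m = F.comp])
    show "F.comp p q \<in> M" if "p \<in> M" "q \<in> M" for p q
      using that M_props(3,4) by blast
    have M_PiE: "p \<in> topspace X \<rightarrow>\<^sub>E topspace X" if "p \<in> M" for p
      using that M_props(3) by (intro F.env_carrier) auto
    show "F.comp (F.comp p q) r = F.comp p (F.comp q r)" if "p \<in> M" "q \<in> M" "r \<in> M" for p q r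
      using M_PiE[OF that(3)] by (rule F.comp_assoc)
    show "continuous_map F.etop F.etop (\<lambda>p. F.comp p q)" if "q \<in> M" for q
      using M_PiE[OF that] by (rule F.continuous_map_comp_right)
  qed
  interpret minimal_ideal_flow G X act M u
    using M u min by unfold_locales
  have equiv: "equiv (topspace X) R"
    unfolding R_def by (rule equiv_NRP)
  have factor: "factor_map G T X act Q actQ \<pi>"
    unfolding Q_def actQ_def \<pi>_def
  proof (rule factor_map_quot_proj[OF tds equiv])
    show "closedin (prod_topology X X) R"
      unfolding R_def by (rule F.closedin_NRP)
    show "(act g x, act g y) \<in> R" if "g \<in> carrier G" "(x, y) \<in> R" for g x y
      using F.NRP_env[of x y d "act g"] that by (simp add: R_def F.act_env)
  qed
  then have fm: "tds G T Q actQ" "continuous_map X Q \<pi>" "\<pi> ` topspace X = topspace Q"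
    "\<And>g x. \<lbrakk>g \<in> carrier G; x \<in> topspace X\<rbrakk> \<Longrightarrow> \<pi> (act g x) = actQ g (\<pi> x)"
    by (auto simp: factor_map_def)
  have \<pi>_eq: "\<pi> x = \<pi> y \<longleftrightarrow> (x, y) \<in> R" if "x \<in> topspace X" "y \<in> topspace X" for x y
    unfolding \<pi>_def using equiv that by (rule quot_proj_eq_iff)
  interpret NRP_quotient G X act M u d Q actQ \<pi>
  proof (intro NRP_quotient.intro NRP_quotient_axioms.intro)
    show "minimal_ideal_flow G X act M u"
      by (rule minimal_ideal_flow_axioms)
    show "flow G Q actQ"
      using fm(1) by (rule tds_flow)
  qed (use fm(2-4) \<pi>_eq in \<open>simp_all add: R_def\<close>)
  have universal: "\<exists>\<psi>. factor_map G T Q actQ Y actY \<psi> \<and> (\<forall>x\<in>topspace X. \<phi> x = \<psi> (\<pi> x))"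
    if \<phi>: "factor_map G T X act Y actY \<phi>" and nil: "nilspace_of_order_at_most Y (dyn_cubes G Y actY) d"
    for Y :: "'b topology" and actY \<phi>
  proof -
    have \<phi>': "tds G T Y actY" "continuous_map X Y \<phi>" "\<phi> ` topspace X = topspace Y"
      "\<And>g x. \<lbrakk>g \<in> carrier G; x \<in> topspace X\<rbrakk> \<Longrightarrow> \<phi> (act g x) = actY g (\<phi> x)"
      using \<phi> by (auto simp: factor_map_def)
    \<comment> \<open>A continuous \<open>\<psi>\<close> comes from the universal property of
      quotient maps; its equivariance is then checked on representatives.\<close>
    have "quotient_map X Q \<pi>"
      unfolding Q_def \<pi>_def by (rule quotient_map_quot_proj)
    moreover have "\<phi> x = \<phi> y" if "x \<in> topspace X" "y \<in> topspace X" "\<pi> x = \<pi> y" for x y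
      using factor_map_NRP[OF \<phi> nil] \<pi>_eq[OF that(1,2)] that(3) by (simp add: R_def)
    ultimately obtain \<psi> where \<psi>: "continuous_map Q Y \<psi>" "\<psi> ` topspace Q = \<phi> ` topspace X"
      "\<And>x. x \<in> topspace X \<Longrightarrow> \<psi> (\<pi> x) = \<phi> x"
      using quotient_map_lift_exists[OF _ \<phi>'(2)] by metis
    have "\<psi> (actQ g q) = actY g (\<psi> q)" if "g \<in> carrier G" and q: "q \<in> topspace Q" for g q
    proof -
      obtain x where "x \<in> topspace X" "q = \<pi> x"
        using q fm(3) by auto
      then show ?thesis
        using that(1) \<psi>(3) \<phi>'(4) by (simp flip: fm(4))
    qed
    then have "factor_map G T Q actQ Y actY \<psi>"
      using fm(1) \<phi>'(1,3) \<psi>(1,2) by (simp add: factor_map_def)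
    then show ?thesis
      using \<psi>(3) by auto
  qed
  show ?thesis
    unfolding Let_def R_def[symmetric] Q_def[symmetric] actQ_def[symmetric] \<pi>_def[symmetric]
    using factor ergodic_Q nilspace_Q universal by simp
qed

end
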